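(* Consider the distributed sequential test described in the context, and let $k=Nr^2$. There is a constant $c>0$, which may be chosen independent of $\epsilon$ and of the thresholds, such that the following holds for every $\epsilon\in(0,1/2)$. Take $\alpha=\beta=\epsilon$ and choose, for all $i=1,\dots,N$, the thresholds $$\gamma_{d,i}^{h}=\frac{8(k+1)}{7N}\left(\log\left(\frac{2}{\epsilon}\right)-\log\left(1-e^{-\frac{Nm}{4(k+1)}}\right)\right),\qquad \gamma_{d,i}^{l}=\frac{8(k+1)}{7N}\left(\log\left(\frac{\epsilon}{2}\right)+\log\left(1-e^{-\frac{Nm}{4(k+1)}}\right)\right).$$ Then the stopping time $T_{d,i}$ of each agent $i$ satisfies $$\frac{(1-2\epsilon)\gamma_{d,i}^{h}}{m}-\frac{c}{m}\ \le\ \mathbb{E}_1[T_{d,i}]\ \le\ \frac{5\gamma_{d,i}^{h}}{4m}+\frac{1}{1-e^{-\frac{Nm}{4(k+1)}}}.$$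
   Context: Observation model: there are $N$ agents; at each time $t=1,2,\dots$ agent $i$ observes $y_i(t)=\mu_\theta+n_i(t)$ under hypothesis $H_\theta$, $\theta\in\{0,1\}$, with $\mu_1=\mu$, $\mu_0=-\mu$, $\mu\neq 0$. The noises $n_i(t)$ are independent over all agents $i$ and times $t$, each Gaussian with mean $0$ and variance $\sigma^2>0$, under both hypotheses. $\mathbb{P}_\theta,\mathbb{E}_\theta$ denote probability and expectation under $H_\theta$. The log-likelihood ratio at agent $i$ is $\eta_i(t)=2\mu y_i(t)/\sigma^2$, and $\boldsymbol\eta(t)=(\eta_1(t),\dots,\eta_N(t))^\top$. Put $m=2\mu^2/\sigma^2$; thus $\eta_i(t)\sim\mathcal N(m,2m)$ under $H_1$ and $\mathcal N(-m,2m)$ under $H_0$ (mean, variance). Network: $G=(V,E)$ is a connected simple undirected graph on the agents $V=\{1,\dots,N\}$. $\mathbf W=[w_{ij}]$ is an $N\times N$ non-negative, symmetric, irreducible, stochastic (rows sum to one) matrix with $w_{ij}=0$ whenever $i\ne j$ and $(i,j)\notin E$. Let $\mathbf J=\frac1N\mathbf 1\mathbf 1^\top$ and $r=\|\mathbf W-\mathbf J\|$ (induced $\mathcal L_2$ norm), and assume $r<1$. Test: the vector of agent statistics $\mathbf S_d(t)=(S_{d,1}(t),\dots,S_{d,N}(t))^\top$ is given by $\mathbf S_d(0)=\mathbf 0$ and $\mathbf S_d(t+1)=\mathbf W(\mathbf S_d(t)+\boldsymbol\eta(t+1))$, i.e. $S_{d,i}(t)=\sum_{j=1}^t\mathbf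 e_i^\top\mathbf W^{t+1-j}\boldsymbol\eta(j)$. Given thresholds $\gamma_{d,i}^l,\gamma_{d,i}^h\in\mathbb R$, the stopping time of agent $i$ is $T_{d,i}=\inf\{t\ge1: S_{d,i}(t)\notin[\gamma_{d,i}^l,\gamma_{d,i}^h]\}$. Here $\alpha$ and $\beta$ are the prescribed upper bounds on the probabilities of false alarm $\mathbb P_0(S_{d,i}(T_{d,i})\ge\gamma_{d,i}^h)$ and of miss $\mathbb P_1(S_{d,i}(T_{d,i})\le\gamma_{d,i}^l)$. The constant $c$ may depend on the network ($G$, $\mathbf W$) and on the model parameters $\mu,\sigma^2$. $\log$ is the natural logarithm. *)

theory Defs
  imports "HOL-Probability.Probability"
begin

datatype hyp = H0 | H1

primrec signal_mean :: "real \<Rightarrow> hyp \<Rightarrow> real" where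
  "signal_mean \<mu> H0 = - \<mu>"
| "signal_mean \<mu> H1 = \<mu>"

text \<open>
  The observations \<^term>\<open>y i t\<close> live on one measurable space carrying the two laws
  \<^term>\<open>P H0\<close> and \<^term>\<open>P H1\<close>; the noise of agent \<^term>\<open>i\<close> at time \<^term>\<open>t\<close> under
  \<^term>\<open>\<theta>\<close> is \<^term>\<open>y i t\<close> minus the signal mean. Time starts at 1, so \<^term>\<open>y i 0\<close> is
  unconstrained and never used. The parameter \<^term>\<open>\<sigma>\<close> is the standard deviation.
\<close>

definition gaussian_shift_model ::
    "real \<Rightarrow> real \<Rightarrow> (hyp \<Rightarrow> 'a measure) \<Rightarrow> ('n::finite \<Rightarrow> nat \<Rightarrow> 'a \<Rightarrow> real) \<Rightarrow> bool" where
  "gaussian_shift_model \<mu> \<sigma> P y \<longleftrightarrow>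
     sets (P H0) = sets (P H1) \<and>
     (\<forall>\<theta>. prob_space (P \<theta>) \<and>
          prob_space.indep_vars (P \<theta>) (\<lambda>_. borel)
            (\<lambda>(i, t) \<omega>. y i t \<omega> - signal_mean \<mu> \<theta>) (UNIV \<times> {1..}) \<and>
          (\<forall>i. \<forall>t\<ge>1. distributed (P \<theta>) lborel
             (\<lambda>\<omega>. y i t \<omega> - signal_mean \<mu> \<theta>) (normal_density 0 \<sigma>)))"

definition connected_simple_graph :: "('n \<times> 'n) set \<Rightarrow> bool" where
  "connected_simple_graph E \<longleftrightarrow> sym E \<and> irrefl E \<and> (\<forall>i j. (i, j) \<in> E\<^sup>*)"

text \<open>
  No simultaneous permutation of rows and columns brings the matrix into block triangular
  form with two nonempty square diagonal blocks; \<^term>\<open>I\<close> is the index set of one block.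
\<close>

definition irreducible_matrix :: "real^'n^'n \<Rightarrow> bool" where
  "irreducible_matrix A \<longleftrightarrow>
     \<not> (\<exists>I. I \<noteq> {} \<and> I \<noteq> UNIV \<and> (\<forall>i\<in>I. \<forall>j\<in>-I. A $ i $ j = 0))"

definition weight_matrix :: "('n::finite \<times> 'n) set \<Rightarrow> real^'n^'n \<Rightarrow> bool" where
  "weight_matrix E W \<longleftrightarrow>
     (\<forall>i j. 0 \<le> W $ i $ j) \<and>
     transpose W = W \<and>
     irreducible_matrix W \<and>
     (\<forall>i. (\<Sum>j\<in>UNIV. W $ i $ j) = 1) \<and>
     (\<forall>i j. i \<noteq> j \<and> (i, j) \<notin> E \<longrightarrow> W $ i $ j = 0)"

definition averaging_matrix :: "real^'n::finite^'n" where
  "averaging_matrix = (\<chi> i j. 1 / real CARD('n))"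

definition llr :: "real \<Rightarrow> real \<Rightarrow> ('n::finite \<Rightarrow> nat \<Rightarrow> 'a \<Rightarrow> real) \<Rightarrow> nat \<Rightarrow> 'a \<Rightarrow> real^'n" where
  "llr \<mu> \<sigma> y t \<omega> = (\<chi> i. 2 * \<mu> * y i t \<omega> / \<sigma>\<^sup>2)"

primrec agent_stat :: "real^'n^'n \<Rightarrow> (nat \<Rightarrow> 'a \<Rightarrow> real^'n) \<Rightarrow> nat \<Rightarrow> 'a \<Rightarrow> real^'n::finite" where
  "agent_stat W \<eta> 0 \<omega> = 0"
| "agent_stat W \<eta> (Suc t) \<omega> = W *v (agent_stat W \<eta> t \<omega> + \<eta> (Suc t) \<omega>)"

text \<open>The value is \<^term>\<open>\<infinity> :: enat\<close> on paths that never leave the interval.\<close>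

definition exit_time ::
    "(nat \<Rightarrow> 'a \<Rightarrow> real^'n::finite) \<Rightarrow> 'n \<Rightarrow> real \<Rightarrow> real \<Rightarrow> 'a \<Rightarrow> enat" where
  "exit_time S i l h \<omega> = Inf (enat ` {t. 1 \<le> t \<and> S t \<omega> $ i \<notin> {l..h}})"

definition expected_time :: "'a measure \<Rightarrow> ('a \<Rightarrow> enat) \<Rightarrow> ereal" where
  "expected_time M T = enn2ereal (\<integral>\<^sup>+ \<omega>. ennreal_of_enat (T \<omega>) \<partial>M)"

end

theory Submission
  imports Defs
begin

text \<open>
  Under \<open>H1\<close> the statistic \<open>S\<^sub>i(t)\<close> is normal with mean \<open>m t\<close> and variance at most \<open>2 m t (k + 1) / N\<close>,
  because each row of a power of \<open>W\<close> splits orthogonally into its consensus part and a remainder of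
  norm at most \<open>r\<close>.

  Upper bound: \<open>E T\<close> is the sum of \<open>P(T > t) \<le> P(S\<^sub>i(t) \<le> \<gamma>)\<close>. For \<open>t \<ge> \<gamma> / m\<close> the Gaussian tail bound, with
  its factor \<open>1/2\<close>, is dominated by a geometric series. The factor \<open>1/2\<close> is what makes the constant
  \<open>5/4\<close> attainable.

  Lower bound: the network average \<open>s\<close> is a random walk with drift \<open>m\<close>, and the deviation from it, of norm
  \<open>u\<close>, contracts by the factor \<open>r\<close> in every step. Hence \<open>\<gamma> - s\<close> minus two exponential correction terms
  in \<open>(s, u)\<close> loses at most \<open>m\<close> in conditional expectation per step, as long as \<open>s \<le> \<gamma>\<close>. This quantity starts
  at \<open>\<gamma> - O(1)\<close>, and the corrections make it non-positive as soon as \<open>S\<^sub>i\<close> leaves \<open>[-\<gamma>, \<gamma>]\<close>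
  or \<open>s\<close> exceeds \<open>\<gamma>\<close>. Summing the drift gives \<open>m E T \<ge> \<gamma> - O(1)\<close>.
\<close>

section \<open>Summation of the Gaussian tail bounds\<close>

text \<open>All terms with \<open>t \<le> \<tau>\<close> are 1 and the rest is geometric. The bound
  is exact for integer \<open>\<tau>\<close>; convexity of \<open>exp\<close> extends it to
  fractional \<open>\<tau>\<close> by linear interpolation, so that rounding \<open>\<tau>\<close>
  costs nothing.\<close>

lemma summable_min_one_exp:
  fixes c \<tau> :: real
  assumes "c > 0" "\<tau> \<ge> 0"
  shows "summable (\<lambda>t. min 1 (exp (- (c * (real t - \<tau>)))))"
    and "(\<Sum>t. min 1 (exp (- (c * (real t - \<tau>))))) \<le> \<tau> + 1 / (1 - exp (- c))"
proof -
  define f where "f t = min 1 (exp (- (c * (real t - \<tau>))))" for t :: nat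
  define n where "n = nat \<lfloor>\<tau>\<rfloor>"
  define \<theta> where "\<theta> = \<tau> - real n"
  define E where "E = exp (- c)"
  have E: "0 < E" "E < 1" using assms by (auto simp: E_def)
  have \<theta>: "0 \<le> \<theta>" "\<theta> \<le> 1"
    using assms(2) unfolding \<theta>_def n_def by linarith+
  have tail: "f (t + Suc n) = exp (- (c * (1 - \<theta>))) * E ^ t" for t
  proof -
    have "- (c * (real (t + Suc n) - \<tau>)) = - (c * (1 - \<theta>)) + real t * (- c)"
      by (simp add: \<theta>_def algebra_simps)
    moreover have "- (c * (1 - \<theta>)) + real t * (- c) \<le> 0"
      using assms \<theta> by (intro add_nonpos_nonpos) (auto simp: mult_nonneg_nonpos)
    ultimately show ?thesis
      unfolding f_def E_def by (simp only: exp_add exp_of_nat_mult) (simp add: mult_le_one min_absorb2 exp_of_nat_mult[symmetric] flip: exp_add)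
  qed
  have sums: "(\<lambda>t. f (t + Suc n)) sums (exp (- (c * (1 - \<theta>))) * (1 / (1 - E)))"
    unfolding tail using E by (intro sums_mult geometric_sums) auto
  then show "summable (\<lambda>t. min 1 (exp (- (c * (real t - \<tau>)))))"
    using summable_iff_shift[of f "Suc n"] by (simp add: sums_iff f_def[abs_def])
  then have "suminf f = (\<Sum>t. f (t + Suc n)) + (\<Sum>t<Suc n. f t)"
    by (intro suminf_split_initial_segment) (simp add: f_def[abs_def])
  also have "(\<Sum>t<Suc n. f t) \<le> real (card {..<Suc n}) * 1"
    by (rule sum_bounded_above) (simp add: f_def)
  also have "(\<Sum>t. f (t + Suc n)) = exp (- (c * (1 - \<theta>))) * (1 / (1 - E))"
    using sums by (simp add: sums_iff)
  also have "exp (- (c * (1 - \<theta>))) \<le> \<theta> + (1 - \<theta>) * E"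
  proof -
    have "exp ((1 - (1 - \<theta>)) *\<^sub>R 0 + (1 - \<theta>) *\<^sub>R (- c)) \<le> (1 - (1 - \<theta>)) * exp 0 + (1 - \<theta>) * exp (- c)"
      using \<theta> by (intro convex_onD[OF convex_on_exp[of 1, simplified]]) auto
    then show ?thesis by (simp add: E_def algebra_simps)
  qed
  finally have "suminf f \<le> (\<theta> + (1 - \<theta>) * E) * (1 / (1 - E)) + real (Suc n)"
    using E by (simp add: mult_right_mono divide_right_mono)
  also have "\<dots> = \<tau> + 1 / (1 - E)"
    using E by (simp add: \<theta>_def field_simps)
  finally show "(\<Sum>t. min 1 (exp (- (c * (real t - \<tau>))))) \<le> \<tau> + 1 / (1 - exp (- c))"
    by (simp add: f_def[abs_def] E_def)
qed

text \<open>Two terms of the series \<open>2 * (y + y^3/3 + ...)\<close> at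
  \<open>y = 1/3\<close>.\<close>

lemma ln_2_ge: "(56/81 :: real) \<le> ln 2"
  using ln_approx_bounds[of 2 2] by (simp add: eval_nat_numeral)

text \<open>With \<open>u = exp (- (q/9))\<close> the claim reduces to
  \<open>u^9 \<le> 2 * u - 1\<close>, that is, to \<open>u + ... + u^8 \<ge> 1\<close>, which holds
  from slightly above \<open>u = 1/2\<close> on. The limit \<open>153/25\<close> lies just below
  \<open>9 * ln 2\<close>, where \<open>u\<close> would be \<open>1/2\<close>.\<close>

lemma half_geometric_le:
  fixes q :: real
  assumes "0 < q" "q \<le> 153/25"
  shows "1/2 + 1/2 * (1 / (1 - exp (- (8/9 * q)))) \<le> 1 / (1 - exp (- q))"
proof -
  define u where "u = exp (- (q/9))"
  have u: "0 < u" "u < 1" using assms by (auto simp: u_def)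
  have u8: "exp (- (8/9 * q)) = u ^ 8" "exp (- q) = u ^ 9"
    by (simp_all add: u_def flip: exp_of_nat_mult)
  have "2 * u = exp (ln 2 - q/9)" by (simp only: u_def diff_conv_add_uminus exp_add) simp
  also have "\<dots> \<ge> 1 + (ln 2 - q/9)" by simp
  \<comment> \<open>The constant rounds down \<open>1 + 56/81 - 17/25\<close>, where
    \<open>17/25\<close> is one ninth of \<open>153/25\<close>.\<close>
  finally have "2 * u \<ge> 10113/10000" using ln_2_ge assms by simp
  then have u': "(316/625) \<le> u" by simp
  have "(1::real) \<le> (316/625) + (316/625)^2 + (316/625)^3 + (316/625)^4 + (316/625)^5 + (316/625)^6 + (316/625)^7 + (316/625)^8"
    by (simp add: power_divide)
  also have "\<dots> \<le> u + u^2 + u^3 + u^4 + u^5 + u^6 + u^7 + u^8"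
    using u' by (intro add_mono power_mono) auto
  finally have "0 \<le> (1 - u) * (u + u^2 + u^3 + u^4 + u^5 + u^6 + u^7 + u^8 - 1)"
    using u by simp
  also have "\<dots> = 2 * u - 1 - u^9" by (simp add: algebra_simps eval_nat_numeral)
  finally have key: "u^9 \<le> 2 * u - 1" by simp
  have lt: "u^8 < 1" "u^9 < 1" using u by (auto simp: power_less_one_iff)
  have "u^8 * (1 - u^9) \<le> 2 * u^9 * (1 - u^8)"
    using mult_left_mono[OF key, of "u^8"] u by (simp add: algebra_simps eval_nat_numeral)
  then show ?thesis unfolding u8 using lt by (simp add: field_simps)
qed

text \<open>The coefficient \<open>7/6\<close> leaves \<open>x/12\<close> to spare against
  \<open>5/4\<close>. By assumption \<open>x\<close> is at least of order \<open>1/q\<close>,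
  whereas the excess of the geometric series over its first term is of order
  \<open>exp (- (3/4 * q))\<close>.\<close>

lemma half_geometric_le_slack:
  fixes q x :: real
  assumes q: "q \<ge> 153/25" and x: "2/7 * ln 4 \<le> q * x"
  shows "7/6 * x + (1/2 + 1/2 * (1 / (1 - exp (- (3/4 * q))))) \<le> 5/4 * x + 1 / (1 - exp (- q))"
proof -
  define p where "p = 3/4 * q"
  have p: "p \<ge> 459/100" using q by (simp add: p_def)
  \<comment> \<open>\<open>459/100\<close> is the least value of \<open>p\<close>. The quadratic
    Taylor bound is sharp only near 0, hence the twentieth root.\<close>
  have "(95 :: real) \<le> (1 + 459/2000 + (459/2000)^2 / 2) ^ 20"
    by (simp add: power2_eq_square power_divide)
  also have "\<dots> \<le> exp (459/2000) ^ 20"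
    by (intro power_mono exp_lower_Taylor_quadratic) auto
  also have "\<dots> = exp (459/100)" by (simp flip: exp_of_nat_mult)
  finally have e0: "95 \<le> exp (459/100 :: real)" .
  \<comment> \<open>The tangent line of \<open>exp\<close> at \<open>459/100\<close> turns the
    numerical value into a linear bound for all larger \<open>p\<close>.\<close>
  have "95 * (1 + (p - 459/100)) \<le> exp (459/100) * exp (p - 459/100)"
    using e0 p by (intro mult_mono exp_ge_add_one_self) auto
  also have "\<dots> = exp p" by (simp flip: exp_add)
  finally have "95 * p - 34105/100 \<le> exp p" by (simp add: algebra_simps)
  then have ep: "1013/50 * p \<le> exp p - 1" using p by simp
  have "ln (4::real) = 2 * ln 2"
    using ln_realpow[of 2 2] by simp
  \<comment> \<open>\<open>79/200\<close> rounds down \<open>2/7 * 2 * 56/81\<close>.\<close>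
  then have "79/200 \<le> q * x" using x ln_2_ge by simp
  then have "79/200 / q \<le> x" using q by (simp add: field_simps)
  then have x': "(237/800) / p \<le> x" using q by (simp add: p_def)
  have "1/2 * (1 / (1 - exp (- p))) = 1/2 + 1/2 * (1 / (exp p - 1))"
    using ep p by (simp add: exp_minus field_simps)
  also have "1 / (exp p - 1) \<le> 1 / (1013/50 * p)"
    using ep p by (intro divide_left_mono) auto
  also have "1/2 + 1/2 * (1 / (1013/50 * p)) \<le> 1/2 + 1/12 * ((237/800) / p)"
    using p by (simp add: field_simps)
  finally have "1/2 * (1 / (1 - exp (- p))) \<le> 1/2 + 1/12 * x" using x' by simp
  moreover have "1 \<le> 1 / (1 - exp (- q))" using q by simp
  ultimately show ?thesis by (simp add: p_def)
qed

text \<open>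
  Where the Gaussian bound is active, the parabola \<open>(t - x)\<^sup>2\<close> is replaced by its tangent at
  \<open>t = x / (1 - s)\<close>, which gives a geometric series. The value of \<open>s\<close> is \<open>2/3\<close> for small \<open>q\<close> and
  \<open>1/2\<close> for large \<open>q\<close>.
\<close>

lemma gaussian_tail_series_tangent:
  fixes q x s :: real and p :: "nat \<Rightarrow> real"
  assumes q: "q > 0" and x: "x > 0" and s: "0 < s" "s < 1"
    and p0: "\<And>t. 0 \<le> p t" and p1: "\<And>t. p t \<le> 1"
    and tail: "\<And>t. x \<le> real t \<Longrightarrow> p t \<le> 1/2 * exp (- (q * (real t - x)\<^sup>2 / real t))"
  shows "summable p"
    and "suminf p \<le> (1/2 + 1 / (2 - s)) * x + (1/2 + 1/2 * (1 / (1 - exp (- ((2 * s - s\<^sup>2) * q)))))"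
proof -
  define c where "c = (2 * s - s\<^sup>2) * q"
  \<comment> \<open>The tangent vanishes at \<open>\<tau>\<close>, so the geometric decay sets in
    there and not at \<open>x\<close>.\<close>
  define \<tau> where "\<tau> = 2 * x / (2 - s)"
  have "s\<^sup>2 < 2 * s" using s by (simp add: power2_eq_square)
  then have c: "c > 0" unfolding c_def using q by simp
  have \<tau>: "\<tau> \<ge> x" unfolding \<tau>_def using s x by (simp add: field_simps)
  define g where "g t = min 1 (exp (- (c * (real t - \<tau>))))" for t :: nat
  define d where "d t = (if real t < x then 1 else 0 :: real)" for t :: nat
  \<comment> \<open>Below \<open>x\<close> the trivial bound 1 is split into two halves; from
    \<open>x\<close> on, the factor \<open>1/2\<close> of the tail bound leaves only the half with
    \<open>g\<close>. Thus only one half extends up to \<open>\<tau>\<close>, which lowers the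
    coefficient of \<open>x\<close>.\<close>
  have le: "p t \<le> 1/2 * d t + 1/2 * g t" for t
  proof (cases "real t < x")
    case True
    then have "c * (real t - \<tau>) \<le> 0" using c \<tau> by (simp add: mult_nonneg_nonpos)
    then have "g t = 1" unfolding g_def by simp
    then show ?thesis using p1[of t] True by (simp add: d_def)
  next
    case False
    then have t: "real t > 0" "x \<le> real t" using x by auto
    have c\<tau>: "c * (real t - \<tau>) = q * ((2 * s - s\<^sup>2) * real t - 2 * s * x)"
      using s by (simp add: c_def \<tau>_def field_simps power2_eq_square)
    have "0 \<le> ((1 - s) * real t - x)\<^sup>2" by simp
    then have "((2 * s - s\<^sup>2) * real t - 2 * s * x) * real t \<le> (real t - x)\<^sup>2"
      by (simp add: power2_eq_square algebra_simps)
    then have "(2 * s - s\<^sup>2) * real t - 2 * s * x \<le> (real t - x)\<^sup>2 / real t"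
      using t by (simp add: pos_le_divide_eq)
    then have "c * (real t - \<tau>) \<le> q * (real t - x)\<^sup>2 / real t"
      unfolding c\<tau> using q by (simp only: times_divide_eq_right[symmetric] mult_left_mono less_imp_le)
    moreover have "0 \<le> q * (real t - x)\<^sup>2 / real t" using q by simp
    ultimately have "exp (- (q * (real t - x)\<^sup>2 / real t)) \<le> g t" by (simp add: g_def)
    then show ?thesis using tail[OF t(2)] False by (simp add: d_def)
  qed
  have g: "summable g" "suminf g \<le> \<tau> + 1 / (1 - exp (- c))"
    using summable_min_one_exp[of c \<tau>] c \<tau> x by (auto simp: g_def[abs_def])
  define n where "n = nat \<lceil>x\<rceil>"
  have d_iff: "real t < x \<longleftrightarrow> t \<in> {..<n}" for t
    unfolding n_def by (simp add: zless_nat_conj less_ceiling_iff nat_less_iff) linarith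
  have d: "d sums real n"
    unfolding d_def d_iff using sums_If_finite_set[of "{..<n}" "\<lambda>_. 1 :: real"] by simp
  have nx: "real n \<le> x + 1" unfolding n_def using x by linarith
  have sumle: "summable (\<lambda>t. 1/2 * d t + 1/2 * g t)"
    using g(1) d by (intro summable_add summable_mult) (auto simp: sums_iff)
  show p: "summable p"
    by (rule summable_comparison_test'[OF sumle, of 0]) (use p0 le in auto)
  have "suminf p \<le> (\<Sum>t. 1/2 * d t + 1/2 * g t)"
    using le p sumle by (intro suminf_le)
  also have "\<dots> = 1/2 * real n + 1/2 * suminf g"
    using g(1) d by (subst suminf_add[symmetric]) (auto simp: sums_iff suminf_divide)
  also have "\<dots> \<le> 1/2 * (x + 1) + 1/2 * (\<tau> + 1 / (1 - exp (- c)))"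
    using g(2) nx by (intro add_mono mult_left_mono) auto
  also have "\<dots> = (1/2 + 1 / (2 - s)) * x + (1/2 + 1/2 * (1 / (1 - exp (- c))))"
    by (simp add: \<tau>_def algebra_simps)
  finally show "suminf p \<le> (1/2 + 1 / (2 - s)) * x + (1/2 + 1/2 * (1 / (1 - exp (- ((2 * s - s\<^sup>2) * q)))))"
    by (simp add: c_def)
qed

text \<open>At \<open>s = 2/3\<close> the coefficient \<open>1/2 + 1 / (2 - s)\<close> is exactly
  \<open>5/4\<close>, so the geometric terms must close the estimate alone, which works while
  \<open>q \<le> 153/25\<close>. For larger \<open>q\<close> the choice \<open>s = 1/2\<close> moves
  the slack to the coefficient of \<open>x\<close>.\<close>

lemma gaussian_tail_series_le:
  fixes q x :: real and p :: "nat \<Rightarrow> real"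
  assumes q: "q > 0" and x: "2/7 * ln 4 \<le> q * x"
    and p: "\<And>t. 0 \<le> p t" "\<And>t. p t \<le> 1"
      "\<And>t. x \<le> real t \<Longrightarrow> p t \<le> 1/2 * exp (- (q * (real t - x)\<^sup>2 / real t))"
  shows "summable p" and "suminf p \<le> 5/4 * x + 1 / (1 - exp (- q))"
proof -
  have "0 < q * x" using x by (rule less_le_trans[rotated]) simp
  then have x0: "x > 0" using q by (simp add: zero_less_mult_iff)
  show "summable p"
    by (rule gaussian_tail_series_tangent[of q x "1/2" p]) (use q x0 p in auto)
  show "suminf p \<le> 5/4 * x + 1 / (1 - exp (- q))"
  proof (cases "q \<le> 153/25")
    case True
    have "suminf p \<le> (1/2 + 1 / (2 - 2/3)) * x + (1/2 + 1/2 * (1 / (1 - exp (- ((2 * (2/3) - (2/3)\<^sup>2) * q)))))"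
      by (rule gaussian_tail_series_tangent) (use q x0 p in auto)
    also have "\<dots> = 5/4 * x + (1/2 + 1/2 * (1 / (1 - exp (- (8/9 * q)))))"
      by (simp add: power2_eq_square)
    also have "\<dots> \<le> 5/4 * x + 1 / (1 - exp (- q))"
      using half_geometric_le[OF q True] by simp
    finally show ?thesis .
  next
    case False
    have "suminf p \<le> (1/2 + 1 / (2 - 1/2)) * x + (1/2 + 1/2 * (1 / (1 - exp (- ((2 * (1/2) - (1/2)\<^sup>2) * q)))))"
      by (rule gaussian_tail_series_tangent) (use q x0 p in auto)
    also have "\<dots> = 7/6 * x + (1/2 + 1/2 * (1 / (1 - exp (- (3/4 * q)))))"
      by (simp add: power2_eq_square)
    also have "\<dots> \<le> 5/4 * x + 1 / (1 - exp (- q))"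
      using half_geometric_le_slack[OF _ x] False by simp
    finally show ?thesis .
  qed
qed

section \<open>Normal random variables\<close>

text \<open>The reflection \<open>2 * g - x\<close> exchanges the two half-lines, which overlap in a
  null set.\<close>

lemma nn_integral_normal_density_lower_half:
  fixes g s :: real
  assumes s: "s > 0"
  shows "(\<integral>\<^sup>+x. ennreal (normal_density g s x) * indicator {..g} x \<partial>lborel) = ennreal (1/2)"
proof -
  define I where "I = (\<integral>\<^sup>+x. ennreal (normal_density g s x) * indicator {..g} x \<partial>lborel)"
  define J where "J = (\<integral>\<^sup>+x. ennreal (normal_density g s x) * indicator {g..} x \<partial>lborel)"
  have "J = (\<integral>\<^sup>+x. ennreal (normal_density g s (2 * g + (-1) * x)) * indicator {g..} (2 * g + (-1) * x) \<partial>lborel)"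
    unfolding J_def by (subst nn_integral_real_affine[where c="-1" and t="2*g"]) auto
  also have "\<dots> = I"
    unfolding I_def by (intro nn_integral_cong)
      (auto simp: normal_density_def power2_commute indicator_def)
  finally have JI: "J = I" .
  have "AE x in lborel. x \<noteq> g" by (rule AE_lborel_singleton)
  then have "I + J = (\<integral>\<^sup>+x. ennreal (normal_density g s x) \<partial>lborel)"
    unfolding I_def J_def
    by (subst nn_integral_add[symmetric]) (auto intro!: nn_integral_cong_AE simp: indicator_def)
  also have "\<dots> = 1"
    using s by (subst nn_integral_eq_integral) auto
  finally have II: "I + I = 1" by (simp add: JI)
  then have "I \<noteq> \<top>" by auto
  then obtain a where a: "I = ennreal a" "a \<ge> 0" by (cases I) auto
  then have "a + a = 1" using II by (simp flip: ennreal_plus ennreal_1)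
  then have "a = 1/2" by simp
  then show ?thesis using a unfolding I_def by (simp only:)
qed

text \<open>For \<open>x \<le> g\<close> the density around \<open>\<nu>\<close> is at most
  \<open>e\<close> times the density around \<open>g\<close>, because the cross term
  \<open>(g - x) * (\<nu> - g)\<close> is nonnegative. The latter density has mass
  \<open>1/2\<close> there, a factor that a Chernoff bound would lose.\<close>

lemma (in prob_space) normal_lower_tail:
  assumes X: "distributed M lborel X (normal_density \<nu> s)" and s: "s > 0" and g: "g \<le> \<nu>"
  shows "prob {\<omega> \<in> space M. X \<omega> \<le> g} \<le> 1/2 * exp (- ((\<nu> - g)\<^sup>2 / (2 * s\<^sup>2)))"
proof -
  define e where "e = exp (- ((\<nu> - g)\<^sup>2 / (2 * s\<^sup>2)))"
  have e0: "0 \<le> e" by (simp add: e_def)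
  have le: "normal_density \<nu> s x \<le> e * normal_density g s x" if "x \<le> g" for x
  proof -
    have "0 \<le> (g - x) * (\<nu> - g)" using g that by simp
    then have "(\<nu> - g)\<^sup>2 + (x - g)\<^sup>2 \<le> (x - \<nu>)\<^sup>2"
      by (simp add: power2_eq_square algebra_simps)
    then have "((\<nu> - g)\<^sup>2 + (x - g)\<^sup>2) / (2 * s\<^sup>2) \<le> (x - \<nu>)\<^sup>2 / (2 * s\<^sup>2)"
      by (rule divide_right_mono) simp
    then have "exp (- (x - \<nu>)\<^sup>2 / (2 * s\<^sup>2)) \<le> e * exp (- (x - g)\<^sup>2 / (2 * s\<^sup>2))"
      by (simp add: e_def add_divide_distrib flip: exp_add)
    then have "1 / sqrt (2 * pi * s\<^sup>2) * exp (- (x - \<nu>)\<^sup>2 / (2 * s\<^sup>2))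
        \<le> 1 / sqrt (2 * pi * s\<^sup>2) * (e * exp (- (x - g)\<^sup>2 / (2 * s\<^sup>2)))"
      by (rule mult_left_mono) simp
    then show ?thesis unfolding normal_density_def by (simp add: ac_simps)
  qed
  have "{\<omega> \<in> space M. X \<omega> \<le> g} = X -` {..g} \<inter> space M" by auto
  then have "emeasure M {\<omega> \<in> space M. X \<omega> \<le> g} = (\<integral>\<^sup>+x. ennreal (normal_density \<nu> s x) * indicator {..g} x \<partial>lborel)"
    using distributed_emeasure[OF X, of "{..g}"] by simp
  also have "\<dots> \<le> (\<integral>\<^sup>+x. ennreal e * (ennreal (normal_density g s x) * indicator {..g} x) \<partial>lborel)"
    by (intro nn_integral_mono) (auto simp: indicator_def le e0 simp flip: ennreal_mult intro!: ennreal_leI)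
  also have "\<dots> = ennreal e * ennreal (1/2)"
    using nn_integral_normal_density_lower_half[OF s, of g] by (simp add: nn_integral_cmult)
  also have "\<dots> = ennreal (1/2 * e)" by (subst mult.commute, rule ennreal_mult[symmetric]) (use e0 in auto)
  finally show ?thesis unfolding e_def[symmetric]
    by (simp add: emeasure_eq_measure e_def)
qed

text \<open>Completing the square: the weight \<open>exp (c * x)\<close> shifts the mean of the
  density by \<open>c * s^2\<close>.\<close>

lemma (in prob_space) normal_exponential_moment:
  assumes X: "distributed M lborel X (normal_density \<nu> s)" and s: "s > 0"
  shows "integrable M (\<lambda>\<omega>. exp (c * X \<omega>))"
    and "expectation (\<lambda>\<omega>. exp (c * X \<omega>)) = exp (c * \<nu> + c\<^sup>2 * s\<^sup>2 / 2)"
proof -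
  have eq: "normal_density \<nu> s x * exp (c * x) = exp (c * \<nu> + c\<^sup>2 * s\<^sup>2 / 2) * normal_density (\<nu> + c * s\<^sup>2) s x" for x
  proof -
    have "- (x - \<nu>)\<^sup>2 / (2 * s\<^sup>2) + c * x = c * \<nu> + c\<^sup>2 * s\<^sup>2 / 2 + - (x - (\<nu> + c * s\<^sup>2))\<^sup>2 / (2 * s\<^sup>2)"
      using s by (simp add: field_simps) (simp add: eval_nat_numeral algebra_simps)
    then have "exp (- (x - \<nu>)\<^sup>2 / (2 * s\<^sup>2)) * exp (c * x)
        = exp (c * \<nu> + c\<^sup>2 * s\<^sup>2 / 2) * exp (- (x - (\<nu> + c * s\<^sup>2))\<^sup>2 / (2 * s\<^sup>2))"
      by (simp only: flip: exp_add)
    then show ?thesis unfolding normal_density_def by simp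
  qed
  have "integrable lborel (\<lambda>x. normal_density \<nu> s x * exp (c * x))"
    unfolding eq using s by auto
  then show "integrable M (\<lambda>\<omega>. exp (c * X \<omega>))"
    using distributed_integrable[OF X, of "\<lambda>x. exp (c * x)"] by simp
  have "expectation (\<lambda>\<omega>. exp (c * X \<omega>)) = (\<integral>x. normal_density \<nu> s x * exp (c * x) \<partial>lborel)"
    using distributed_integral[OF X, of "\<lambda>x. exp (c * x)"] by simp
  then show "expectation (\<lambda>\<omega>. exp (c * X \<omega>)) = exp (c * \<nu> + c\<^sup>2 * s\<^sup>2 / 2)"
    unfolding eq using s by simp
qed

lemma (in prob_space) normal_linear_combination:
  fixes X :: "'i \<Rightarrow> 'a \<Rightarrow> real"
  assumes "finite I" and indep: "indep_vars (\<lambda>_. borel) X I" and s: "s > 0"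
    and X: "\<And>i. i \<in> I \<Longrightarrow> distributed M lborel (X i) (normal_density \<nu> s)"
    and nz: "(\<Sum>i\<in>I. (a i)\<^sup>2) \<noteq> 0"
  shows "distributed M lborel (\<lambda>\<omega>. \<Sum>i\<in>I. a i * X i \<omega>)
    (normal_density ((\<Sum>i\<in>I. a i) * \<nu>) (sqrt (s\<^sup>2 * (\<Sum>i\<in>I. (a i)\<^sup>2))))"
proof -
  \<comment> \<open>A summand with coefficient 0 is constant and has no density, so the sum is taken
    over the support of \<open>a\<close>.\<close>
  define J where "J = {i \<in> I. a i \<noteq> 0}"
  have J: "finite J" "J \<subseteq> I" using assms(1) by (auto simp: J_def)
  have ne: "J \<noteq> {}"
  proof
    assume "J = {}"
    then have "(\<Sum>i\<in>I. (a i)\<^sup>2) = 0" by (intro sum.neutral) (auto simp: J_def)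
    then show False using nz by simp
  qed
  have "distributed M lborel (\<lambda>\<omega>. \<Sum>i\<in>J. a i * X i \<omega>)
      (normal_density (\<Sum>i\<in>J. a i * \<nu>) (sqrt (\<Sum>i\<in>J. (\<bar>a i\<bar> * s)\<^sup>2)))"
  proof (rule sum_indep_normal)
    show "indep_vars (\<lambda>_. borel) (\<lambda>i \<omega>. a i * X i \<omega>) J"
      by (rule indep_vars_compose2[OF indep_vars_subset[OF indep J(2)]]) auto
    show "distributed M lborel (\<lambda>\<omega>. a i * X i \<omega>) (normal_density (a i * \<nu>) (\<bar>a i\<bar> * s))" if "i \<in> J" for i
      using normal_density_affine[OF X s, of i "a i" 0] that by (auto simp: J_def)
  qed (use J ne s in \<open>auto simp: J_def\<close>)
  also have "(\<lambda>\<omega>. \<Sum>i\<in>J. a i * X i \<omega>) = (\<lambda>\<omega>. \<Sum>i\<in>I. a i * X i \<omega>)"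
    using assms(1) by (intro ext sum.mono_neutral_left) (auto simp: J_def)
  also have "(\<Sum>i\<in>J. a i * \<nu>) = (\<Sum>i\<in>I. a i) * \<nu>"
    unfolding sum_distrib_right using assms(1) by (intro sum.mono_neutral_left) (auto simp: J_def)
  also have "(\<Sum>i\<in>J. (\<bar>a i\<bar> * s)\<^sup>2) = s\<^sup>2 * (\<Sum>i\<in>I. (a i)\<^sup>2)"
    unfolding sum_distrib_left using assms(1)
    by (intro sum.mono_neutral_cong_left) (auto simp: J_def power_mult_distrib)
  finally show ?thesis .
qed

section \<open>Averages, deviations and the weight matrix\<close>

definition vmean :: "real^'n::finite \<Rightarrow> real" where
  "vmean v = (\<Sum>i\<in>UNIV. v $ i) / real CARD('n)"

definition deviation :: "real^'n::finite \<Rightarrow> real^'n" where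
  "deviation v = (\<chi> i. v $ i - vmean v)"

lemma vmean_add: "vmean (u + v) = vmean u + vmean v"
  by (simp add: vmean_def sum.distrib add_divide_distrib)

lemma deviation_add: "deviation (u + v) = deviation u + deviation v"
  by (simp add: deviation_def vmean_add vec_eq_iff)

text \<open>Pythagoras for the orthogonal splitting of \<open>v\<close> into a constant vector and a
  vector of sum zero.\<close>

lemma norm_power2_decompose:
  "(norm (v :: real^'n::finite))\<^sup>2 = real CARD('n) * (vmean v)\<^sup>2 + (norm (deviation v))\<^sup>2"
proof -
  have sq: "(norm u)\<^sup>2 = (\<Sum>i\<in>UNIV. (u $ i)\<^sup>2)" for u :: "real^'n"
    unfolding power2_norm_eq_inner inner_vec_def by (simp add: power2_eq_square)
  have s: "(\<Sum>i\<in>UNIV. v $ i) = real CARD('n) * vmean v" by (simp add: vmean_def)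
  have "(norm (deviation v))\<^sup>2 = (\<Sum>i\<in>UNIV. (v $ i)\<^sup>2 - 2 * vmean v * v $ i + (vmean v)\<^sup>2)"
    unfolding sq by (simp add: deviation_def power2_eq_square algebra_simps)
  also have "\<dots> = (norm v)\<^sup>2 - 2 * vmean v * (real CARD('n) * vmean v) + real CARD('n) * (vmean v)\<^sup>2"
    by (simp add: sum.distrib sum_subtractf sq s flip: sum_distrib_left)
  finally show ?thesis by (simp add: power2_eq_square)
qed

lemma norm_deviation_le: "norm (deviation v) \<le> norm v"
  by (rule power2_le_imp_le) (simp_all add: norm_power2_decompose[of v])

lemma abs_vmean_le: "\<bar>vmean v\<bar> \<le> norm (v :: real^'n::finite)"
proof -
  have "1 * (vmean v)\<^sup>2 \<le> real CARD('n) * (vmean v)\<^sup>2"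
    by (intro mult_right_mono) (simp_all add: Suc_leI)
  then have "\<bar>vmean v\<bar>\<^sup>2 \<le> (norm v)\<^sup>2" unfolding norm_power2_decompose[of v] power2_abs
    using zero_le_power2[of "norm (deviation v)"] by linarith
  then show ?thesis by (rule power2_le_imp_le) simp
qed

section \<open>Action of a weight matrix on averages and deviations\<close>

context
  fixes E :: "('n::finite \<times> 'n) set" and W :: "real^'n^'n"
  assumes W: "weight_matrix E W"
begin

lemma weight_matrix_row_sum: "(\<Sum>j\<in>UNIV. W $ i $ j) = 1"
  and weight_matrix_sym: "W $ i $ j = W $ j $ i"
proof -
  show "(\<Sum>j\<in>UNIV. W $ i $ j) = 1" using W by (simp add: weight_matrix_def)
  have "transpose W $ j $ i = W $ j $ i" using W by (simp add: weight_matrix_def)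
  then show "W $ i $ j = W $ j $ i" by (simp add: transpose_def)
qed

lemma vmean_weight_matrix: "vmean (W *v x) = vmean x"
proof -
  have "(\<Sum>i\<in>UNIV. \<Sum>j\<in>UNIV. W $ i $ j * x $ j) = (\<Sum>j\<in>UNIV. \<Sum>i\<in>UNIV. W $ j $ i * x $ j)"
    by (subst sum.swap) (simp add: weight_matrix_sym)
  also have "\<dots> = (\<Sum>j\<in>UNIV. x $ j)"
    by (simp add: weight_matrix_row_sum flip: sum_distrib_right)
  finally show ?thesis by (simp add: vmean_def matrix_vector_mult_def)
qed

text \<open>Rows summing to one make \<open>W\<close> preserve constant vectors, and the averaging
  matrix annihilates vectors of sum zero. Hence the operator norm of
  \<open>W - averaging_matrix\<close> is the contraction factor of the deviation.\<close>

lemma deviation_weight_matrix: "deviation (W *v x) = (W - averaging_matrix) *v deviation x"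
proof -
  have "(\<Sum>j\<in>UNIV. (W $ i $ j - 1 / real CARD('n)) * (x $ j - vmean x)) = (\<Sum>j\<in>UNIV. W $ i $ j * x $ j) - vmean x" for i
  proof -
    have "(\<Sum>j\<in>UNIV. (W $ i $ j - 1 / real CARD('n)) * (x $ j - vmean x))
       = (\<Sum>j\<in>UNIV. W $ i $ j * x $ j) - (\<Sum>j\<in>UNIV. W $ i $ j) * vmean x
         - (\<Sum>j\<in>UNIV. x $ j) / real CARD('n) + (\<Sum>j\<in>(UNIV :: 'n set). vmean x / real CARD('n))"
      unfolding sum_distrib_right sum_divide_distrib sum_subtractf[symmetric] sum.distrib[symmetric]
      by (intro sum.cong) (auto simp: algebra_simps diff_divide_distrib)
    then show ?thesis by (simp add: weight_matrix_row_sum) (simp add: vmean_def)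
  qed
  then show ?thesis
    unfolding deviation_def[of "W *v x"] vmean_weight_matrix
    by (simp add: vec_eq_iff matrix_vector_mult_def averaging_matrix_def deviation_def)
qed

lemma norm_deviation_weight_matrix:
  "norm (deviation (W *v x)) \<le> onorm (\<lambda>x. (W - averaging_matrix) *v x) * norm (deviation x)"
  unfolding deviation_weight_matrix by (rule onorm) simp

lemma inner_weight_matrix: "inner v (W *v x) = inner (W *v v) x"
proof -
  have "transpose W = W" using W by (simp add: weight_matrix_def)
  then have "W *v v = v v* W" using transpose_matrix_vector[of W v] by simp
  then show ?thesis by (simp add: dot_lmul_matrix)
qed

text \<open>By symmetry \<open>W\<close> moves to the test vector, which is why the induction runs
  over all \<open>v\<close>. A unit vector \<open>v\<close> exhibits an agent's statistic as a
  linear combination of the observations.\<close>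

lemma inner_agent_stat:
  "inner v (agent_stat W \<eta> t \<omega>) = (\<Sum>j\<in>{1..t}. inner (((*v) W ^^ (t + 1 - j)) v) (\<eta> j \<omega>))"
proof (induction t arbitrary: v)
  case (Suc t)
  have "(\<Sum>j\<in>{1..Suc t}. inner (((*v) W ^^ (Suc t + 1 - j)) v) (\<eta> j \<omega>))
    = (\<Sum>j\<in>{1..t}. inner (((*v) W ^^ (Suc t + 1 - j)) v) (\<eta> j \<omega>)) + inner (W *v v) (\<eta> (Suc t) \<omega>)"
    by simp
  also have "(\<Sum>j\<in>{1..t}. inner (((*v) W ^^ (Suc t + 1 - j)) v) (\<eta> j \<omega>))
    = (\<Sum>j\<in>{1..t}. inner (((*v) W ^^ (t + 1 - j)) (W *v v)) (\<eta> j \<omega>))"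
    by (intro sum.cong refl) (simp add: Suc_diff_le funpow_swap1)
  also have "\<dots> + inner (W *v v) (\<eta> (Suc t) \<omega>) = inner v (agent_stat W \<eta> (Suc t) \<omega>)"
    by (simp add: inner_weight_matrix inner_add_right Suc.IH)
  finally show ?case by simp
qed simp

lemma vmean_funpow_weight_matrix: "vmean (((*v) W ^^ s) v) = vmean v"
  by (induction s) (simp_all add: vmean_weight_matrix)

text \<open>Pythagoras: the consensus component of a row of a power of \<open>W\<close> has squared norm \<open>1/N\<close>.\<close>

lemma norm_weight_matrix_power_row:
  fixes i :: 'n and s :: nat
  defines "r \<equiv> onorm (\<lambda>x. (W - averaging_matrix) *v x)"
  defines "w \<equiv> ((*v) W ^^ s) (axis i 1)"
  assumes r: "r < 1"
  shows "(\<Sum>l\<in>UNIV. w $ l) = 1"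
    and "1 / real CARD('n) \<le> (norm w)\<^sup>2"
    and "s \<ge> 1 \<Longrightarrow> (norm w)\<^sup>2 \<le> (real CARD('n) * r\<^sup>2 + 1) / real CARD('n)"
proof -
  have r0: "0 \<le> r" unfolding r_def by (rule onorm_pos_le) simp
  have "(\<Sum>l\<in>UNIV. axis i (1::real) $ l) = 1" by (simp add: axis_def)
  then have m: "vmean w = 1 / real CARD('n)"
    unfolding w_def vmean_funpow_weight_matrix by (simp add: vmean_def)
  then show "(\<Sum>l\<in>UNIV. w $ l) = 1" by (simp add: vmean_def)
  have eq: "(norm w)\<^sup>2 = 1 / real CARD('n) + (norm (deviation w))\<^sup>2"
    unfolding norm_power2_decompose[of w] m by (simp add: power2_eq_square)
  then show "1 / real CARD('n) \<le> (norm w)\<^sup>2" by simp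
  assume "s \<ge> 1"
  have "norm (deviation (((*v) W ^^ n) (axis i 1))) \<le> r ^ n" for n
  proof (induction n)
    case 0
    then show ?case using norm_deviation_le[of "axis i (1::real)"] by simp
  next
    case (Suc n)
    have "norm (deviation (((*v) W ^^ Suc n) (axis i 1))) \<le> r * norm (deviation (((*v) W ^^ n) (axis i 1)))"
      unfolding r_def using norm_deviation_weight_matrix by simp
    also have "\<dots> \<le> r * r ^ n" using Suc r0 by (rule mult_left_mono)
    finally show ?case by simp
  qed
  then have "norm (deviation w) \<le> r ^ s" by (simp add: w_def)
  \<comment> \<open>The assumption \<open>s \<ge> 1\<close> enters here. In the statistic every
    exponent \<open>t + 1 - j\<close> is at least 1, since even the newest observation has been
    averaged once.\<close>
  also have "\<dots> \<le> r ^ 1" using r r0 \<open>s \<ge> 1\<close> by (intro power_decreasing) auto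
  finally have "(norm (deviation w))\<^sup>2 \<le> r\<^sup>2" by (intro power_mono) auto
  then show "(norm w)\<^sup>2 \<le> (real CARD('n) * r\<^sup>2 + 1) / real CARD('n)"
    unfolding eq by (simp add: field_simps)
qed

end

section \<open>The statistics of the consensus recursion\<close>

text \<open>The sigma-algebras generated by \<open>U\<close> and \<open>Y\<close> lie in
  \<open>sets F\<close> and \<open>sets G\<close>, and independence passes to subfamilies.\<close>

lemma (in prob_space) indep_var_of_indep_set:
  assumes indep: "indep_set (sets F) (sets G)" and space: "space F = space M" "space G = space M"
    and U: "U \<in> measurable F S" and Y: "Y \<in> measurable G T"
  shows "indep_var S U T Y"
proof -
  have sub: "sets F \<subseteq> events" "sets G \<subseteq> events"
    using indep_setD_ev1[OF indep] indep_setD_ev2[OF indep] .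
  have U': "{U -` A \<inter> space M |A. A \<in> sets S} \<subseteq> sets F"
    using measurable_sets[OF U] by (auto simp: space)
  have Y': "{Y -` A \<inter> space M |A. A \<in> sets T} \<subseteq> sets G"
    using measurable_sets[OF Y] by (auto simp: space)
  have sU: "sigma_sets (space M) {U -` A \<inter> space M |A. A \<in> sets S} \<subseteq> sets F"
    using sets.sigma_sets_subset[OF U'] space by simp
  have sY: "sigma_sets (space M) {Y -` A \<inter> space M |A. A \<in> sets T} \<subseteq> sets G"
    using sets.sigma_sets_subset[OF Y'] space by simp
  have rU: "U \<in> measurable M S"
    using U measurable_sets[OF U] sub by (auto simp: measurable_def space)
  have rY: "Y \<in> measurable M T"
    using Y measurable_sets[OF Y] sub by (auto simp: measurable_def space)
  have "indep_set (sigma_sets (space M) {U -` A \<inter> space M |A. A \<in> sets S})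
      (sigma_sets (space M) {Y -` A \<inter> space M |A. A \<in> sets T})"
    using indep sU sY sub unfolding indep_sets2_eq by blast
  then show ?thesis using rU rY by (simp add: indep_var_eq)
qed

lemma borel_measurable_vmean [measurable]: "vmean \<in> borel_measurable borel"
  unfolding vmean_def[abs_def] by measurable

lemma borel_measurable_vecI:
  fixes f :: "'a \<Rightarrow> real^'n::finite"
  assumes "\<And>i. (\<lambda>x. f x $ i) \<in> borel_measurable M"
  shows "f \<in> borel_measurable M"
  using assms by (subst borel_measurable_euclidean_space) (auto simp: Basis_vec_def inner_axis)

lemma borel_measurable_deviation [measurable]: "deviation \<in> borel_measurable borel"
  unfolding deviation_def[abs_def] by (rule borel_measurable_vecI) simp

lemma borel_measurable_matrix_vector_mult [measurable]: "(*v) (A :: real^'n^'m::finite) \<in> borel_measurable borel"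
  by (intro borel_measurable_continuous_onI linear_continuous_on matrix_vector_mul_bounded_linear)

text \<open>The model under \<open>H1\<close>, restated through the log-likelihood ratios, so that
  \<open>\<mu>\<close> and \<open>\<sigma>\<close> enter only through \<open>m\<close>.\<close>

locale gaussian_consensus = prob_space M
  for M :: "'a measure" +
  fixes \<eta> :: "nat \<Rightarrow> 'a \<Rightarrow> real^'n::finite" and m r :: real
    and E :: "('n \<times> 'n) set" and W :: "real^'n^'n"
  assumes m_pos: "m > 0"
    and indep: "indep_vars (\<lambda>_. borel) (\<lambda>(i, t) \<omega>. \<eta> t \<omega> $ i) (UNIV \<times> {1..})"
    and normal: "t \<ge> 1 \<Longrightarrow> distributed M lborel (\<lambda>\<omega>. \<eta> t \<omega> $ i) (normal_density m (sqrt (2 * m)))"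
    and weight: "weight_matrix E W"
    and r_eq: "r = onorm (\<lambda>x. (W - averaging_matrix) *v x)"
    and r_less_1: "r < 1"
begin

abbreviation "S \<equiv> agent_stat W \<eta>"

lemma r_nonneg: "0 \<le> r"
  unfolding r_eq by (rule onorm_pos_le) simp

text \<open>The sigma-algebra generated by the observations at the times in \<open>K\<close>. A set
  of times, rather than a last time, lets the past \<open>{1..t}\<close> and the next step
  \<open>{Suc t}\<close> be instances of one notion.\<close>

definition hist :: "nat set \<Rightarrow> 'a measure" where
  "hist K = vimage_algebra (space M)
     (\<lambda>\<omega>. restrict (\<lambda>p. (case p of (i, t) \<Rightarrow> \<eta> t \<omega> $ i)) (UNIV \<times> K)) (PiM (UNIV \<times> K) (\<lambda>_. borel))"

lemma space_hist [simp]: "space (hist K) = space M"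
  by (simp add: hist_def)

lemma measurable_hist:
  assumes "t \<in> K" shows "\<eta> t \<in> borel_measurable (hist K)"
proof (rule borel_measurable_vecI)
  fix i
  have "(\<lambda>\<omega>. restrict (\<lambda>p. (case p of (i, t) \<Rightarrow> \<eta> t \<omega> $ i)) (UNIV \<times> K)) \<in> measurable (hist K) (PiM (UNIV \<times> K) (\<lambda>_. borel))"
    unfolding hist_def by (rule measurable_vimage_algebra1) (auto simp: space_PiM)
  from measurable_compose[OF this measurable_component_singleton[of "(i, t)"]] assms
  show "(\<lambda>\<omega>. \<eta> t \<omega> $ i) \<in> borel_measurable (hist K)" by simp
qed

lemma indep_hist:
  assumes "K \<inter> L = {}" "K \<subseteq> {1..}" "L \<subseteq> {1..}"
    and "U \<in> borel_measurable (hist K)" "Y \<in> borel_measurable (hist L)"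
  shows "indep_var borel U borel Y"
proof (rule indep_var_of_indep_set[OF _ space_hist space_hist assms(4,5)])
  have "indep_var (PiM (UNIV \<times> K) (\<lambda>_. borel)) (\<lambda>\<omega>. restrict (\<lambda>p. (case p of (i, t) \<Rightarrow> (\<lambda>\<omega>. \<eta> t \<omega> $ i)) \<omega>) (UNIV \<times> K))
      (PiM (UNIV \<times> L) (\<lambda>_. borel)) (\<lambda>\<omega>. restrict (\<lambda>p. (case p of (i, t) \<Rightarrow> (\<lambda>\<omega>. \<eta> t \<omega> $ i)) \<omega>) (UNIV \<times> L))"
    using assms by (intro indep_var_restrict[OF indep]) auto
  then show "indep_set (sets (hist K)) (sets (hist L))"
    unfolding hist_def sets_vimage_algebra indep_var_eq by (simp add: case_prod_unfold)
qed

lemma sets_hist_subset: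
  assumes "K \<subseteq> {1..}" shows "sets (hist K) \<subseteq> events"
proof -
  have "(\<lambda>\<omega>. restrict (\<lambda>p. (case p of (i, t) \<Rightarrow> \<eta> t \<omega> $ i)) (UNIV \<times> K)) \<in> measurable M (PiM (UNIV \<times> K) (\<lambda>_. borel))"
    using indep assms by (intro measurable_restrict) (auto simp: indep_vars_def2)
  then show ?thesis
    unfolding hist_def sets_vimage_algebra by (intro sets.sigma_sets_subset) (auto dest: measurable_sets)
qed

lemma measurable_hist_imp_measurable:
  assumes "K \<subseteq> {1..}" and f: "f \<in> measurable (hist K) N"
  shows "f \<in> measurable M N"
  using measurable_sets[OF f] measurable_space[OF f] sets_hist_subset[OF assms(1)]
  by (auto simp: measurable_def)

lemma measurable_eta [measurable]: "t \<ge> 1 \<Longrightarrow> \<eta> t \<in> borel_measurable M"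
  by (rule measurable_hist_imp_measurable[of "{t}"]) (auto intro: measurable_hist)

lemma measurable_S_hist: "t \<le> n \<Longrightarrow> S t \<in> borel_measurable (hist {1..n})"
proof (induction t)
  case 0
  have "S 0 = (\<lambda>_. 0)" by auto
  then show ?case by simp
next
  case (Suc t)
  have [measurable]: "\<eta> (Suc t) \<in> borel_measurable (hist {1..n})" "S t \<in> borel_measurable (hist {1..n})"
    using Suc by (auto intro: measurable_hist)
  have "S (Suc t) = (\<lambda>\<omega>. W *v (S t \<omega> + \<eta> (Suc t) \<omega>))" by auto
  also have "\<dots> \<in> borel_measurable (hist {1..n})" by measurable
  finally show ?case .
qed

lemma measurable_S [measurable]: "S t \<in> borel_measurable M"
  by (rule measurable_hist_imp_measurable[OF _ measurable_S_hist[of t t]]) auto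

lemma measurable_S_nth [measurable]: "(\<lambda>\<omega>. S t \<omega> $ i) \<in> borel_measurable M"
  using measurable_compose[OF measurable_S borel_measurable_nth] .

text \<open>The coefficient rows of the unrolled statistic sum to 1, so the mean is exactly
  \<open>m * t\<close>. The squared norms of the rows are only bounded, hence the standard deviation
  is obtained with an upper bound.\<close>

lemma normal_S:
  assumes t: "t \<ge> 1"
  obtains s where "s > 0" "s\<^sup>2 \<le> 2 * m * real t * ((real CARD('n) * r\<^sup>2 + 1) / real CARD('n))"
    "distributed M lborel (\<lambda>\<omega>. S t \<omega> $ i) (normal_density (m * real t) s)"
proof -
  define w where "w j = ((*v) W ^^ (t + 1 - j)) (axis i 1)" for j
  define I where "I = (UNIV :: 'n set) \<times> {1..t}"
  define a where "a = (\<lambda>(l, j). w j $ l)"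
  have row: "(\<Sum>l\<in>UNIV. w j $ l) = 1" "1 / real CARD('n) \<le> (norm (w j))\<^sup>2"
    "j \<in> {1..t} \<Longrightarrow> (norm (w j))\<^sup>2 \<le> (real CARD('n) * r\<^sup>2 + 1) / real CARD('n)" for j
    unfolding w_def r_eq using norm_weight_matrix_power_row[OF weight r_less_1[unfolded r_eq]] by auto
  have sq: "(norm u)\<^sup>2 = (\<Sum>l\<in>UNIV. (u $ l)\<^sup>2)" for u :: "real^'n"
    unfolding power2_norm_eq_inner inner_vec_def by (simp add: power2_eq_square)
  have swap: "(\<Sum>p\<in>I. f p) = (\<Sum>j\<in>{1..t}. \<Sum>l\<in>UNIV. f (l, j))" for f :: "'n \<times> nat \<Rightarrow> real"
    unfolding I_def by (subst sum.swap) (simp add: sum.cartesian_product)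
  have "(\<Sum>p\<in>I. a p) = (\<Sum>j\<in>{1..t}. \<Sum>l\<in>UNIV. w j $ l)" unfolding swap a_def by simp
  then have a1: "(\<Sum>p\<in>I. a p) = real t" by (simp add: row(1))
  have a2: "(\<Sum>p\<in>I. (a p)\<^sup>2) = (\<Sum>j\<in>{1..t}. (norm (w j))\<^sup>2)" unfolding swap a_def sq by simp
  \<comment> \<open>The consensus part \<open>1/N\<close> of every row keeps the variance positive,
    so that a density exists.\<close>
  have "(\<Sum>j\<in>{1..t}. (norm (w j))\<^sup>2) \<ge> real (card {1..t}) * (1 / real CARD('n))"
    using row(2) by (intro sum_bounded_below) auto
  moreover have "real (card {1..t}) * (1 / real CARD('n)) > 0" using t by simp
  ultimately have a2_pos: "(\<Sum>p\<in>I. (a p)\<^sup>2) > 0" unfolding a2 by linarith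
  have "(\<Sum>j\<in>{1..t}. (norm (w j))\<^sup>2) \<le> real (card {1..t}) * ((real CARD('n) * r\<^sup>2 + 1) / real CARD('n))"
    using row(3) by (intro sum_bounded_above) auto
  then have a2_le: "(\<Sum>p\<in>I. (a p)\<^sup>2) \<le> real t * ((real CARD('n) * r\<^sup>2 + 1) / real CARD('n))"
    unfolding a2 by simp
  have "distributed M lborel (\<lambda>\<omega>. \<Sum>p\<in>I. a p * (case p of (i, t) \<Rightarrow> (\<lambda>\<omega>. \<eta> t \<omega> $ i)) \<omega>)
      (normal_density ((\<Sum>p\<in>I. a p) * m) (sqrt ((sqrt (2 * m))\<^sup>2 * (\<Sum>p\<in>I. (a p)\<^sup>2))))"
  proof (rule normal_linear_combination)
    show "indep_vars (\<lambda>_. borel) (\<lambda>(i, t) \<omega>. \<eta> t \<omega> $ i) I"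
      by (rule indep_vars_subset[OF indep]) (auto simp: I_def)
  qed (use a2_pos m_pos normal in \<open>auto simp: I_def\<close>)
  also have "(\<lambda>\<omega>. \<Sum>p\<in>I. a p * (case p of (i, t) \<Rightarrow> (\<lambda>\<omega>. \<eta> t \<omega> $ i)) \<omega>) = (\<lambda>\<omega>. S t \<omega> $ i)"
  proof
    fix \<omega>
    have "S t \<omega> $ i = inner (axis i 1) (S t \<omega>)" by (simp add: inner_axis' )
    also have "\<dots> = (\<Sum>j\<in>{1..t}. \<Sum>l\<in>UNIV. w j $ l * \<eta> j \<omega> $ l)"
      unfolding inner_agent_stat[OF weight] w_def by (simp add: inner_vec_def)
    also have "\<dots> = (\<Sum>p\<in>I. a p * (case p of (i, t) \<Rightarrow> (\<lambda>\<omega>. \<eta> t \<omega> $ i)) \<omega>)"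
      unfolding swap by (simp add: a_def)
    finally show "(\<Sum>p\<in>I. a p * (case p of (i, t) \<Rightarrow> (\<lambda>\<omega>. \<eta> t \<omega> $ i)) \<omega>) = S t \<omega> $ i" by simp
  qed
  finally have D: "distributed M lborel (\<lambda>\<omega>. S t \<omega> $ i) (normal_density (m * real t) (sqrt (2 * m * (\<Sum>p\<in>I. (a p)\<^sup>2))))"
    using m_pos by (simp add: a1 mult.commute)
  show thesis
  proof (rule that[OF _ _ D])
    show "sqrt (2 * m * (\<Sum>p\<in>I. (a p)\<^sup>2)) > 0" using a2_pos m_pos by simp
    have "(sqrt (2 * m * (\<Sum>p\<in>I. (a p)\<^sup>2)))\<^sup>2 = 2 * m * (\<Sum>p\<in>I. (a p)\<^sup>2)"
      using a2_pos m_pos by simp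
    also have "\<dots> \<le> 2 * m * (real t * ((real CARD('n) * r\<^sup>2 + 1) / real CARD('n)))"
      using a2_le m_pos by (intro mult_left_mono) auto
    finally show "(sqrt (2 * m * (\<Sum>p\<in>I. (a p)\<^sup>2)))\<^sup>2 \<le> 2 * m * real t * ((real CARD('n) * r\<^sup>2 + 1) / real CARD('n))"
      by (simp only: mult.assoc)
  qed
qed

section \<open>Tail sum formula for the exit time and the upper bound\<close>

lemma less_exit_time_iff:
  "enat t < exit_time S i l h \<omega> \<longleftrightarrow> (\<forall>s\<in>{1..t}. S s \<omega> $ i \<in> {l..h})"
proof -
  have "enat t < exit_time S i l h \<omega> \<longleftrightarrow> enat (Suc t) \<le> exit_time S i l h \<omega>"
    by (simp add: Suc_ile_eq)
  also have "\<dots> \<longleftrightarrow> (\<forall>s. 1 \<le> s \<and> S s \<omega> $ i \<notin> {l..h} \<longrightarrow> Suc t \<le> s)"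
    unfolding exit_time_def by (auto simp: le_Inf_iff)
  also have "\<dots> \<longleftrightarrow> (\<forall>s\<in>{1..t}. S s \<omega> $ i \<in> {l..h})"
    by (auto simp: not_less_eq_eq)
  finally show ?thesis .
qed

text \<open>The expectation is the sum of the probabilities of the events \<open>t < T\<close>. The
  term for \<open>t = 0\<close> is 1, as \<open>{1..0}\<close> is empty; infinite exit times are
  covered because the sum is taken in \<open>ennreal\<close>.\<close>

lemma expected_time_exit_time:
  "expected_time M (exit_time S i l h)
    = enn2ereal (\<Sum>t. ennreal (prob {\<omega> \<in> space M. \<forall>s\<in>{1..t}. S s \<omega> $ i \<in> {l..h}}))"
proof -
  have "exit_time S i l h \<in> measurable M (count_space UNIV)"
    unfolding measurable_count_space_eq2_countable
  proof (intro conjI ballI)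
    show "exit_time S i l h \<in> space M \<rightarrow> UNIV" by simp
    have lt: "{\<omega> \<in> space M. enat t < exit_time S i l h \<omega>} \<in> events" for t
      unfolding less_exit_time_iff by measurable
    fix e :: enat
    show "exit_time S i l h -` {e} \<inter> space M \<in> events"
    proof (cases e)
      case (enat t)
      have "exit_time S i l h -` {e} \<inter> space M
        = {\<omega> \<in> space M. \<forall>s<t. enat s < exit_time S i l h \<omega>} - {\<omega> \<in> space M. enat t < exit_time S i l h \<omega>}"
      proof -
        have "(x = enat t) \<longleftrightarrow> (\<forall>s<t. enat s < x) \<and> \<not> enat t < x" for x
        proof (cases x)
          case (enat u)
          then show ?thesis by (auto simp: not_less) (meson linorder_neqE_nat less_irrefl not_le)
        qed simp
        then show ?thesis using enat by blast
      qed
      also have "\<dots> \<in> events"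
        using lt by (intro sets.Diff sets.sets_Collect_countable_Ball) auto
      finally show ?thesis .
    next
      case infinity
      have inf_iff: "x = \<infinity> \<longleftrightarrow> (\<forall>s. enat s < x)" for x by (cases x) auto
      have "exit_time S i l h -` {e} \<inter> space M = {\<omega> \<in> space M. \<forall>s. enat s < exit_time S i l h \<omega>}"
        unfolding infinity inf_iff[symmetric] by auto
      also have "\<dots> \<in> events" using lt by (intro sets.sets_Collect_countable_All) auto
      finally show ?thesis .
    qed
  qed
  then show ?thesis
    unfolding expected_time_def by (simp add: nn_integral_enat_function less_exit_time_iff emeasure_eq_measure)
qed

text \<open>By \<open>less_exit_time_iff\<close>, the event that the exit time exceeds
  \<open>t\<close>.\<close>

definition alive :: "'n \<Rightarrow> real \<Rightarrow> real \<Rightarrow> nat \<Rightarrow> 'a set" where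
  "alive i l h t = {\<omega> \<in> space M. \<forall>s\<in>{1..t}. S s \<omega> $ i \<in> {l..h}}"

text \<open>No exit up to time \<open>t\<close> forces the statistic at the single time
  \<open>t\<close> to lie below \<open>\<gamma>\<close>, hence below its mean \<open>m * t\<close>,
  and the Gaussian lower tail applies.\<close>

lemma prob_alive_tail:
  fixes i :: 'n and l \<gamma> :: real
  defines "N \<equiv> real CARD('n)"
  defines "q \<equiv> N * m / (4 * (N * r\<^sup>2 + 1))"
  assumes \<gamma>: "\<gamma> > 0" and t: "\<gamma> / m \<le> real t"
  shows "prob (alive i l \<gamma> t) \<le> 1/2 * exp (- (q * (real t - \<gamma> / m)\<^sup>2 / real t))"
proof -
  have N: "N > 0" by (simp add: N_def)
  have k: "N * r\<^sup>2 + 1 > 0" using N by (simp add: add_nonneg_pos)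
  have "\<gamma> / m > 0" using \<gamma> m_pos by simp
  then have t1: "t \<ge> 1" using t by linarith
  have \<gamma>t: "\<gamma> \<le> m * real t" using t m_pos by (simp add: field_simps)
  obtain s where s: "s > 0" "s\<^sup>2 \<le> 2 * m * real t * ((N * r\<^sup>2 + 1) / N)"
    and D: "distributed M lborel (\<lambda>\<omega>. S t \<omega> $ i) (normal_density (m * real t) s)"
    unfolding N_def by (rule normal_S[OF t1])
  have "prob (alive i l \<gamma> t) \<le> prob {\<omega> \<in> space M. S t \<omega> $ i \<le> \<gamma>}"
    using t1 unfolding alive_def by (intro finite_measure_mono) auto
  also have "\<dots> \<le> 1/2 * exp (- ((m * real t - \<gamma>)\<^sup>2 / (2 * s\<^sup>2)))"
    by (rule normal_lower_tail[OF D s(1) \<gamma>t])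
  also have "\<dots> \<le> 1/2 * exp (- (q * (real t - \<gamma> / m)\<^sup>2 / real t))"
  proof -
    \<comment> \<open>For the largest variance that \<open>normal_S\<close> admits, the Gaussian
      exponent is exactly the one with rate \<open>q\<close>.\<close>
    have "q * (real t - \<gamma> / m)\<^sup>2 / real t = (m * real t - \<gamma>)\<^sup>2 / (2 * (2 * m * real t * ((N * r\<^sup>2 + 1) / N)))"
    proof -
      have "real t - \<gamma> / m = (m * real t - \<gamma>) / m" using m_pos by (simp add: field_simps)
      then have "q * (real t - \<gamma> / m)\<^sup>2 / real t = N * m / (4 * (N * r\<^sup>2 + 1)) * (m * real t - \<gamma>)\<^sup>2 / m\<^sup>2 / real t"
        unfolding q_def by (simp add: power_divide)
      also have "\<dots> = (m * real t - \<gamma>)\<^sup>2 / (2 * (2 * m * real t * ((N * r\<^sup>2 + 1) / N)))"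
        using m_pos N by (simp add: power2_eq_square[of m]) (simp add: algebra_simps)
      finally show ?thesis .
    qed
    also have "\<dots> \<le> (m * real t - \<gamma>)\<^sup>2 / (2 * s\<^sup>2)"
      using s m_pos N k t1 by (intro divide_left_mono mult_pos_pos) auto
    finally show ?thesis by simp
  qed
  finally show ?thesis .
qed

text \<open>The series bound at \<open>x = \<gamma> / m\<close>. Summability is recorded because the
  lower bound relies on these probabilities tending to 0.\<close>

lemma expected_exit_time_upper:
  fixes i :: 'n and l \<gamma> :: real
  defines "N \<equiv> real CARD('n)"
  defines "q \<equiv> N * m / (4 * (N * r\<^sup>2 + 1))"
  assumes \<gamma>: "2/7 * ln 4 \<le> q * (\<gamma> / m)"
  shows "summable (\<lambda>t. prob (alive i l \<gamma> t))"
    and "expected_time M (exit_time S i l \<gamma>) = ereal (\<Sum>t. prob (alive i l \<gamma> t))"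
    and "expected_time M (exit_time S i l \<gamma>) \<le> ereal (5/4 * (\<gamma> / m) + 1 / (1 - exp (- q)))"
proof -
  have "N > 0" by (simp add: N_def)
  then have q: "q > 0" unfolding q_def using m_pos by (simp add: add_nonneg_pos)
  have "0 < q * (\<gamma> / m)" using \<gamma> by (rule less_le_trans[rotated]) simp
  then have \<gamma>0: "\<gamma> > 0" using q m_pos by (simp add: zero_less_mult_iff zero_less_divide_iff)
  have tail: "prob (alive i l \<gamma> t) \<le> 1/2 * exp (- (q * (real t - \<gamma> / m)\<^sup>2 / real t))" if "\<gamma> / m \<le> real t" for t
    using prob_alive_tail[OF \<gamma>0 that] by (simp add: q_def N_def)
  note series = gaussian_tail_series_le[OF q \<gamma>, of "\<lambda>t. prob (alive i l \<gamma> t)", OF _ _ tail]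
  show sm: "summable (\<lambda>t. prob (alive i l \<gamma> t))" by (rule series) auto
  have "(\<Sum>t. ennreal (prob (alive i l \<gamma> t))) = ennreal (\<Sum>t. prob (alive i l \<gamma> t))"
    using sm by (intro suminf_ennreal2) auto
  then show eq: "expected_time M (exit_time S i l \<gamma>) = ereal (\<Sum>t. prob (alive i l \<gamma> t))"
    unfolding expected_time_exit_time alive_def[symmetric] using sm by (simp add: suminf_nonneg)
  show "expected_time M (exit_time S i l \<gamma>) \<le> ereal (5/4 * (\<gamma> / m) + 1 / (1 - exp (- q)))"
    unfolding eq ereal_less_eq by (rule series) auto
qed

end

section \<open>Exponential moments\<close>

text \<open>As \<open>r < 1\<close>, the left side has the smaller growth rate, and \<open>C\<close>
  only has to cover arguments below the crossing point \<open>v\<close>. This turns the contraction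
  of the deviation into a drift inequality for \<open>exp (2 * u)\<close>.\<close>

lemma exp_contraction_bound:
  fixes r B :: real
  assumes r: "0 \<le> r" "r < 1" and B: "B > 0"
  shows "\<exists>C\<ge>0. \<forall>u\<ge>0. B * exp (2 * r * u) \<le> exp (2 * u) + C"
proof -
  define v where "v = ln B / (2 * (1 - r))"
  have "B * exp (2 * r * u) \<le> exp (2 * u) + B * exp (2 * r * v)" if "u \<ge> 0" for u
  proof (cases "u \<le> v")
    case True
    then have "B * exp (2 * r * u) \<le> B * exp (2 * r * v)" using r B by (simp add: mult_left_mono)
    then show ?thesis by (simp add: add_increasing)
  next
    case False
    then have "ln B \<le> 2 * (1 - r) * u" using r by (simp add: v_def field_simps)
    then have "B \<le> exp (2 * (1 - r) * u)" using B by (simp add: ln_ge_iff ln_le_cancel_iff[symmetric] del: ln_le_cancel_iff)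
    then have "B * exp (2 * r * u) \<le> exp (2 * (1 - r) * u) * exp (2 * r * u)" by simp
    also have "\<dots> = exp (2 * u)" by (simp add: algebra_simps flip: exp_add)
    also have "\<dots> \<le> exp (2 * u) + B * exp (2 * r * v)" using B by simp
    finally show ?thesis .
  qed
  moreover have "B * exp (2 * r * v) \<ge> 0" using B by simp
  ultimately show ?thesis by blast
qed

text \<open>\<open>N\<close> times the sum of the values at \<open>c * N\<close> and
  \<open>- (c * N)\<close> of the moment generating function of a normal variable with mean
  \<open>m\<close> and variance \<open>2 * m\<close>.\<close>

definition exp_norm_bound :: "real \<Rightarrow> real \<Rightarrow> real \<Rightarrow> real" where
  "exp_norm_bound N m c = N * (exp (c * N * m + (c * N)\<^sup>2 * m) + exp (- (c * N * m) + (c * N)\<^sup>2 * m))"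

text \<open>The norm is at most \<open>CARD('n)\<close> times the largest absolute entry; the two
  signs in the exponent replace the absolute value, and the sum over all \<open>i\<close> replaces
  the maximum.\<close>

lemma exp_norm_le_sum:
  fixes v :: "real^'n::finite"
  assumes c: "c \<ge> 0"
  shows "exp (c * norm v) \<le> (\<Sum>i\<in>UNIV. exp (c * real CARD('n) * v $ i) + exp (- (c * real CARD('n)) * v $ i))"
proof -
  obtain i where i: "\<And>j. \<bar>v $ j\<bar> \<le> \<bar>v $ i\<bar>"
    using Max_in[of "range (\<lambda>j. \<bar>v $ j\<bar>)"] Max_ge[of "range (\<lambda>j. \<bar>v $ j\<bar>)"] by fastforce
  have "norm v \<le> (\<Sum>j\<in>UNIV. \<bar>v $ j\<bar>)" by (rule norm_le_l1_cart)
  also have "\<dots> \<le> real CARD('n) * \<bar>v $ i\<bar>" using i by (intro sum_bounded_above) auto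
  finally have "c * norm v \<le> c * (real CARD('n) * \<bar>v $ i\<bar>)" using c by (rule mult_left_mono)
  then have "exp (c * norm v) \<le> exp (c * real CARD('n) * \<bar>v $ i\<bar>)" by (simp add: mult.assoc)
  also have "\<dots> \<le> exp (c * real CARD('n) * v $ i) + exp (- (c * real CARD('n)) * v $ i)"
    by (cases "v $ i \<ge> 0") (auto simp: add_increasing add_increasing2)
  also have "\<dots> \<le> (\<Sum>i\<in>UNIV. exp (c * real CARD('n) * v $ i) + exp (- (c * real CARD('n)) * v $ i))"
    by (rule member_le_sum) (auto intro: add_nonneg_nonneg)
  finally show ?thesis .
qed

section \<open>Moments of the increments and of the state\<close>

context gaussian_consensus
begin

lemma integrable_exp_norm_eta:
  assumes t: "t \<ge> 1" and c: "c \<ge> 0"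
  shows "integrable M (\<lambda>\<omega>. exp (c * norm (\<eta> t \<omega>)))"
    and "expectation (\<lambda>\<omega>. exp (c * norm (\<eta> t \<omega>))) \<le> exp_norm_bound (real CARD('n)) m c"
proof -
  note [measurable] = measurable_eta[OF t]
  define N where "N = real CARD('n)"
  have s: "sqrt (2 * m) > 0" "(sqrt (2 * m))\<^sup>2 = 2 * m" using m_pos by auto
  note mom = normal_exponential_moment[OF normal[OF t] s(1), unfolded s(2)]
  have int: "integrable M (\<lambda>\<omega>. \<Sum>i\<in>UNIV. exp (c * N * \<eta> t \<omega> $ i) + exp (- (c * N) * \<eta> t \<omega> $ i))"
    by (intro Bochner_Integration.integrable_sum Bochner_Integration.integrable_add mom)
  have le: "exp (c * norm (\<eta> t \<omega>)) \<le> (\<Sum>i\<in>UNIV. exp (c * N * \<eta> t \<omega> $ i) + exp (- (c * N) * \<eta> t \<omega> $ i))" for \<omega>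
    unfolding N_def by (rule exp_norm_le_sum[OF c])
  show I: "integrable M (\<lambda>\<omega>. exp (c * norm (\<eta> t \<omega>)))"
  proof (rule Bochner_Integration.integrable_bound[OF int])
    show "AE \<omega> in M. norm (exp (c * norm (\<eta> t \<omega>))) \<le> norm (\<Sum>i\<in>UNIV. exp (c * N * \<eta> t \<omega> $ i) + exp (- (c * N) * \<eta> t \<omega> $ i))"
      using le by (auto intro!: AE_I2 order_trans[OF _ abs_ge_self])
  qed measurable
  have "expectation (\<lambda>\<omega>. exp (c * norm (\<eta> t \<omega>)))
      \<le> expectation (\<lambda>\<omega>. \<Sum>i\<in>UNIV. exp (c * N * \<eta> t \<omega> $ i) + exp (- (c * N) * \<eta> t \<omega> $ i))"
    using I int le by (intro integral_mono)
  also have "\<dots> = (\<Sum>i\<in>(UNIV :: 'n set). exp (c * N * m + (c * N)\<^sup>2 * m) + exp (- (c * N) * m + (- (c * N))\<^sup>2 * m))"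
  proof -
    have "expectation (\<lambda>\<omega>. exp (c * N * \<eta> t \<omega> $ i) + exp (- (c * N) * \<eta> t \<omega> $ i))
        = exp (c * N * m + (c * N)\<^sup>2 * m) + exp (- (c * N) * m + (- (c * N))\<^sup>2 * m)" for i
      unfolding Bochner_Integration.integral_add[OF mom(1) mom(1)] mom(2) by simp
    then show ?thesis
      by (subst Bochner_Integration.integral_sum) (intro Bochner_Integration.integrable_add mom(1), simp only:)
  qed
  also have "\<dots> = exp_norm_bound N m c"
    by (simp add: exp_norm_bound_def N_def)
  finally show "expectation (\<lambda>\<omega>. exp (c * norm (\<eta> t \<omega>))) \<le> exp_norm_bound (real CARD('n)) m c"
    by (simp add: N_def)
qed

lemma normal_vmean_eta:
  assumes t: "t \<ge> 1"
  shows "distributed M lborel (\<lambda>\<omega>. vmean (\<eta> t \<omega>)) (normal_density m (sqrt (2 * m / real CARD('n))))"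
proof -
  define I where "I = (UNIV :: 'n set) \<times> {t}"
  have sum_I: "(\<Sum>p\<in>I. f p) = (\<Sum>i\<in>UNIV. f (i, t))" for f :: "'n \<times> nat \<Rightarrow> real"
    unfolding I_def sum.cartesian_product[symmetric, where g="\<lambda>x y. f (x, y)", simplified] by simp
  have "distributed M lborel (\<lambda>\<omega>. \<Sum>p\<in>I. (1 / real CARD('n)) * (case p of (i, t) \<Rightarrow> (\<lambda>\<omega>. \<eta> t \<omega> $ i)) \<omega>)
      (normal_density ((\<Sum>p\<in>I. 1 / real CARD('n)) * m) (sqrt ((sqrt (2 * m))\<^sup>2 * (\<Sum>p\<in>I. (1 / real CARD('n))\<^sup>2))))"
  proof (rule normal_linear_combination)
    show "indep_vars (\<lambda>_. borel) (\<lambda>(i, t) \<omega>. \<eta> t \<omega> $ i) I"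
      by (rule indep_vars_subset[OF indep]) (use t in \<open>auto simp: I_def\<close>)
  qed (use m_pos normal t in \<open>auto simp: I_def card_cartesian_product\<close>)
  also have "(\<lambda>\<omega>. \<Sum>p\<in>I. (1 / real CARD('n)) * (case p of (i, t) \<Rightarrow> (\<lambda>\<omega>. \<eta> t \<omega> $ i)) \<omega>) = (\<lambda>\<omega>. vmean (\<eta> t \<omega>))"
    unfolding sum_I by (simp add: vmean_def sum_divide_distrib)
  finally show ?thesis using m_pos
    by (simp add: I_def card_cartesian_product power2_eq_square)
qed

lemma vmean_eta_moments:
  assumes t: "t \<ge> 1"
  shows "integrable M (\<lambda>\<omega>. vmean (\<eta> t \<omega>))" "expectation (\<lambda>\<omega>. vmean (\<eta> t \<omega>)) = m"
    and "integrable M (\<lambda>\<omega>. exp (c * vmean (\<eta> t \<omega>)))"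
    and "expectation (\<lambda>\<omega>. exp (vmean (\<eta> t \<omega>))) \<ge> 1 + m"
    and "expectation (\<lambda>\<omega>. exp (- (vmean (\<eta> t \<omega>) / 2))) \<le> exp (- (m / 4))"
proof -
  note D = normal_vmean_eta[OF t]
  have s: "sqrt (2 * m / real CARD('n)) > 0" using m_pos by simp
  note mom = normal_exponential_moment[OF D s]
  show "integrable M (\<lambda>\<omega>. exp (c * vmean (\<eta> t \<omega>)))" by (rule mom)
  show "integrable M (\<lambda>\<omega>. vmean (\<eta> t \<omega>))"
    by (rule distributed_integrable_var[OF D]) (use integrable_normal_moment_nz_1[OF s] in auto)
  show "expectation (\<lambda>\<omega>. vmean (\<eta> t \<omega>)) = m"
    using distributed_integral[OF D, of "\<lambda>x. x"] integral_normal_moment_nz_1[OF s] by simp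
  have "1 + m \<le> exp m" by simp
  also have "\<dots> \<le> expectation (\<lambda>\<omega>. exp (1 * vmean (\<eta> t \<omega>)))"
    unfolding mom using m_pos by simp
  finally show "expectation (\<lambda>\<omega>. exp (vmean (\<eta> t \<omega>))) \<ge> 1 + m" by simp
  \<comment> \<open>The exponent is \<open>- m/2 + m / (4 * N)\<close> with
    \<open>N = CARD('n)\<close>, and \<open>N \<ge> 1\<close>.\<close>
  have "expectation (\<lambda>\<omega>. exp ((-1/2) * vmean (\<eta> t \<omega>))) \<le> exp (- (m / 4))"
  proof -
    have N1: "real CARD('n) \<ge> 1" by (simp add: Suc_leI)
    then have "m / real CARD('n) \<le> m" using m_pos by (simp add: field_simps)
    then have "m / (4 * real CARD('n)) \<le> m / 4" by simp
    then show ?thesis unfolding mom using m_pos by (simp add: power2_eq_square)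
  qed
  then show "expectation (\<lambda>\<omega>. exp (- (vmean (\<eta> t \<omega>) / 2))) \<le> exp (- (m / 4))" by simp
qed

text \<open>Takes the place of conditioning on the first \<open>t\<close> observations.\<close>

lemma indep_past_next:
  fixes g :: "real^'n \<Rightarrow> real"
  assumes U: "U \<in> borel_measurable (hist {1..t})" "integrable M U"
    and g: "g \<in> borel_measurable borel" "integrable M (\<lambda>\<omega>. g (\<eta> (Suc t) \<omega>))"
  shows "integrable M (\<lambda>\<omega>. U \<omega> * g (\<eta> (Suc t) \<omega>))"
    and "expectation (\<lambda>\<omega>. U \<omega> * g (\<eta> (Suc t) \<omega>)) = expectation U * expectation (\<lambda>\<omega>. g (\<eta> (Suc t) \<omega>))"
proof -
  have "(\<lambda>\<omega>. g (\<eta> (Suc t) \<omega>)) \<in> borel_measurable (hist {Suc t})"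
    using measurable_compose[OF measurable_hist g(1), of "Suc t" "{Suc t}"] by simp
  then have "indep_var borel U borel (\<lambda>\<omega>. g (\<eta> (Suc t) \<omega>))"
    by (intro indep_hist[OF _ _ _ U(1)]) auto
  then show "integrable M (\<lambda>\<omega>. U \<omega> * g (\<eta> (Suc t) \<omega>))"
    "expectation (\<lambda>\<omega>. U \<omega> * g (\<eta> (Suc t) \<omega>)) = expectation U * expectation (\<lambda>\<omega>. g (\<eta> (Suc t) \<omega>))"
    using U(2) g(2) by (auto intro: indep_var_integrable indep_var_lebesgue_integral)
qed

lemma vmean_S_Suc: "vmean (S (Suc t) \<omega>) = vmean (S t \<omega>) + vmean (\<eta> (Suc t) \<omega>)"
  by (simp add: vmean_weight_matrix[OF weight] vmean_add)

lemma norm_deviation_S_Suc: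
  "norm (deviation (S (Suc t) \<omega>)) \<le> r * (norm (deviation (S t \<omega>)) + norm (\<eta> (Suc t) \<omega>))"
proof -
  have "norm (deviation (S (Suc t) \<omega>)) \<le> r * norm (deviation (S t \<omega>) + deviation (\<eta> (Suc t) \<omega>))"
    using norm_deviation_weight_matrix[OF weight, of "S t \<omega> + \<eta> (Suc t) \<omega>"]
    by (simp add: r_eq deviation_add)
  also have "\<dots> \<le> r * (norm (deviation (S t \<omega>)) + norm (\<eta> (Suc t) \<omega>))"
    using norm_deviation_le[of "\<eta> (Suc t) \<omega>"] norm_triangle_ineq[of "deviation (S t \<omega>)" "deviation (\<eta> (Suc t) \<omega>)"]
    by (intro mult_left_mono[OF _ r_nonneg]) linarith
  finally show ?thesis .
qed

text \<open>The quantity \<open>G\<close> grows per step by at most twice the norm of the new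
  increment, which is independent of the past and has all exponential moments.\<close>

lemma integrable_exp_state:
  "integrable M (\<lambda>\<omega>. exp (a * vmean (S t \<omega>) + b * norm (deviation (S t \<omega>))))"
proof -
  define G where "G t \<omega> = \<bar>vmean (S t \<omega>)\<bar> + norm (deviation (S t \<omega>))" for t \<omega>
  have [measurable]: "G t \<in> borel_measurable M" for t unfolding G_def by measurable
  have int: "integrable M (\<lambda>\<omega>. exp (c * G t \<omega>))" if c: "c \<ge> 0" for c
  proof (induction t)
    case 0
    show ?case by (simp add: G_def vmean_def deviation_def)
  next
    case (Suc t)
    have [measurable]: "G t \<in> borel_measurable (hist {1..t})"
      unfolding G_def using measurable_S_hist[of t t, measurable] by measurable
    have int: "integrable M (\<lambda>\<omega>. exp (c * G t \<omega>) * exp (2 * c * norm (\<eta> (Suc t) \<omega>)))"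
    proof (rule indep_past_next(1)[OF _ Suc])
      show "(\<lambda>\<omega>. exp (c * G t \<omega>)) \<in> borel_measurable (hist {1..t})" by measurable
      show "integrable M (\<lambda>\<omega>. exp (2 * c * norm (\<eta> (Suc t) \<omega>)))"
        using c by (intro integrable_exp_norm_eta) auto
    qed measurable
    have le: "G (Suc t) \<omega> \<le> G t \<omega> + 2 * norm (\<eta> (Suc t) \<omega>)" for \<omega>
    proof -
      have "r * (norm (deviation (S t \<omega>)) + norm (\<eta> (Suc t) \<omega>)) \<le> 1 * (norm (deviation (S t \<omega>)) + norm (\<eta> (Suc t) \<omega>))"
        using r_less_1 by (intro mult_right_mono) auto
      then have "norm (deviation (S (Suc t) \<omega>)) \<le> norm (deviation (S t \<omega>)) + norm (\<eta> (Suc t) \<omega>)"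
        using order_trans[OF norm_deviation_S_Suc[of t \<omega>]] by simp
      then show ?thesis
        using abs_vmean_le[of "\<eta> (Suc t) \<omega>"] unfolding G_def vmean_S_Suc by linarith
    qed
    have "exp (c * G (Suc t) \<omega>) \<le> exp (c * G t \<omega>) * exp (2 * c * norm (\<eta> (Suc t) \<omega>))" for \<omega>
      using mult_left_mono[OF le c] by (simp add: algebra_simps flip: exp_add)
    then show ?case by (intro Bochner_Integration.integrable_bound[OF int]) auto
  qed
  have bound: "a * vmean (S t \<omega>) + b * norm (deviation (S t \<omega>)) \<le> (\<bar>a\<bar> + \<bar>b\<bar>) * G t \<omega>" for \<omega>
  proof -
    have "a * vmean (S t \<omega>) \<le> \<bar>a\<bar> * \<bar>vmean (S t \<omega>)\<bar>" by (metis abs_ge_self abs_mult)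
    moreover have "b * norm (deviation (S t \<omega>)) \<le> \<bar>b\<bar> * norm (deviation (S t \<omega>))"
      by (intro mult_right_mono) auto
    moreover have "0 \<le> \<bar>b\<bar> * \<bar>vmean (S t \<omega>)\<bar>" "0 \<le> \<bar>a\<bar> * norm (deviation (S t \<omega>))" by auto
    ultimately show ?thesis unfolding G_def distrib_left distrib_right by linarith
  qed
  show ?thesis
    by (rule Bochner_Integration.integrable_bound[OF int[of "\<bar>a\<bar> + \<bar>b\<bar>"]]) (use bound in auto)
qed

lemma integrable_vmean_S: "integrable M (\<lambda>\<omega>. vmean (S t \<omega>))"
proof (induction t)
  case 0
  show ?case by (simp add: vmean_def)
next
  case (Suc t)
  then show ?case unfolding vmean_S_Suc by (intro Bochner_Integration.integrable_add vmean_eta_moments) auto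
qed

text \<open>The bound is uniform in \<open>t\<close>: by the contraction, the means obey a recursion
  \<open>a -> r * (a + B)\<close>, which does not leave the range below
  \<open>B / (1 - r)\<close>.\<close>

lemma expectation_norm_deviation_S:
  shows "integrable M (\<lambda>\<omega>. norm (deviation (S t \<omega>)))"
    and "expectation (\<lambda>\<omega>. norm (deviation (S t \<omega>))) \<le> exp_norm_bound (real CARD('n)) m 3 / (1 - r)"
proof -
  define B where "B = exp_norm_bound (real CARD('n)) m 3"
  have B: "B \<ge> 0" by (simp add: B_def exp_norm_bound_def)
  show int: "integrable M (\<lambda>\<omega>. norm (deviation (S t \<omega>)))" for t
  proof (rule Bochner_Integration.integrable_bound[OF integrable_exp_state[of 0 t 1]])
    show "AE \<omega> in M. norm (norm (deviation (S t \<omega>))) \<le> norm (exp (0 * vmean (S t \<omega>) + 1 * norm (deviation (S t \<omega>))))"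
      by (intro AE_I2) (simp, metis exp_ge_add_one_self add_increasing zero_le_one order_trans less_eq_real_def less_add_one add.commute)
  qed measurable
  \<comment> \<open>Crude on purpose: the exponential moment at rate 3 is the constant
    \<open>B\<close> that the potential uses as well.\<close>
  have norm_le: "norm (\<eta> t \<omega>) \<le> exp (3 * norm (\<eta> t \<omega>))" for t \<omega>
    using exp_ge_add_one_self[of "3 * norm (\<eta> t \<omega>)"] norm_ge_zero[of "\<eta> t \<omega>"] by linarith
  have int_eta: "integrable M (\<lambda>\<omega>. norm (\<eta> (Suc t) \<omega>))" for t
    by (rule Bochner_Integration.integrable_bound[OF integrable_exp_norm_eta(1)[of "Suc t" 3]]) (use norm_le in auto)
  have "expectation (\<lambda>\<omega>. norm (deviation (S t \<omega>))) \<le> B / (1 - r)"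
  proof (induction t)
    case 0
    show ?case using B r_less_1 by (simp add: deviation_def vmean_def norm_vec_def L2_set_def)
  next
    case (Suc t)
    have "expectation (\<lambda>\<omega>. norm (\<eta> (Suc t) \<omega>)) \<le> expectation (\<lambda>\<omega>. exp (3 * norm (\<eta> (Suc t) \<omega>)))"
      using norm_le int_eta by (intro integral_mono integrable_exp_norm_eta) auto
    also have "\<dots> \<le> B" unfolding B_def by (intro integrable_exp_norm_eta) auto
    finally have eta: "expectation (\<lambda>\<omega>. norm (\<eta> (Suc t) \<omega>)) \<le> B" .
    have "expectation (\<lambda>\<omega>. norm (deviation (S (Suc t) \<omega>)))
        \<le> expectation (\<lambda>\<omega>. r * (norm (deviation (S t \<omega>)) + norm (\<eta> (Suc t) \<omega>)))"
      by (intro integral_mono int int_eta norm_deviation_S_Suc integrable_mult_right Bochner_Integration.integrable_add)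
    also have "\<dots> = r * (expectation (\<lambda>\<omega>. norm (deviation (S t \<omega>))) + expectation (\<lambda>\<omega>. norm (\<eta> (Suc t) \<omega>)))"
      using int int_eta by simp
    also have "\<dots> \<le> r * (B / (1 - r) + B)"
      using Suc eta by (intro mult_left_mono[OF _ r_nonneg]) simp
    also have "\<dots> = (r * (2 - r)) * B / (1 - r)" using r_less_1 by (simp add: field_simps)
    also have "\<dots> \<le> 1 * B / (1 - r)"
    proof (intro divide_right_mono mult_right_mono)
      have "0 \<le> (1 - r)\<^sup>2" by simp
      then show "r * (2 - r) \<le> 1" by (simp add: power2_eq_square algebra_simps)
    qed (use B r_less_1 in auto)
    finally show ?case by simp
  qed
  then show "expectation (\<lambda>\<omega>. norm (deviation (S t \<omega>))) \<le> exp_norm_bound (real CARD('n)) m 3 / (1 - r)"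
    by (simp add: B_def)
qed

end

section \<open>The potential\<close>

text \<open>
  The first exponential term controls an exit of the statistic above \<open>\<gamma>\<close> while \<open>s \<le> \<gamma>\<close>, and the square
  pays for its drift. The last term controls an exit below \<open>-\<gamma>\<close> and, through \<open>L\<close>, its own drift.
\<close>

definition potential :: "real \<Rightarrow> real \<Rightarrow> real \<Rightarrow> real \<Rightarrow> real \<Rightarrow> real \<Rightarrow> real" where
  "potential K \<delta> L \<gamma> s u = (\<gamma> - s) - exp (2 * u - (\<gamma> - s)) - K * \<delta> * (exp (- (\<gamma> - s)) - 1 / (2 * \<delta>))\<^sup>2
     - 4 * exp (- (s / 2)) * (exp (2 * u) + L)"

text \<open>Each way out is paid for by one term. If \<open>s > \<gamma>\<close>, the leading term
  is negative. If \<open>x > \<gamma>\<close>, then \<open>u\<close> exceeds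
  \<open>\<gamma> - s\<close> and the first exponential dominates. If \<open>x < - \<gamma>\<close>,
  then \<open>u\<close> exceeds \<open>s + \<gamma>\<close> and the last term dominates.\<close>

lemma potential_exit_nonpos:
  assumes nn: "K \<ge> 0" "\<delta> \<ge> 0" "L \<ge> 0" and u: "\<bar>x - s\<bar> \<le> u"
    and exit: "\<not> (x \<in> {-\<gamma>..\<gamma>} \<and> s \<le> \<gamma>)"
  shows "potential K \<delta> L \<gamma> s u \<le> 0"
proof -
  have nn1: "0 \<le> exp (2 * u - (\<gamma> - s))" "0 \<le> K * \<delta> * (exp (- (\<gamma> - s)) - 1 / (2 * \<delta>))\<^sup>2"
    using nn by auto
  have nn2: "4 * exp (2 * u - s / 2) \<le> 4 * exp (- (s / 2)) * (exp (2 * u) + L)"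
  proof -
    have "exp (2 * u - s / 2) = exp (- (s / 2)) * exp (2 * u)" by (simp flip: exp_add)
    then show ?thesis using nn by simp
  qed
  have nn3: "0 \<le> exp (2 * u - s / 2)" by simp
  consider "s > \<gamma>" | "s \<le> \<gamma>" "x > \<gamma>" | "s \<le> \<gamma>" "x < - \<gamma>" using exit by force
  then show ?thesis
  proof cases
    case 1
    then show ?thesis unfolding potential_def using nn1 nn2 nn3 by linarith
  next
    case 2
    have "2 * u - (\<gamma> - s) \<ge> \<gamma> - s" using 2 u by linarith
    then have "exp (2 * u - (\<gamma> - s)) \<ge> 1 + (\<gamma> - s)"
      using exp_ge_add_one_self[of "2 * u - (\<gamma> - s)"] by linarith
    then show ?thesis unfolding potential_def using nn1 nn2 nn3 by linarith
  next
    case 3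
    have "u \<ge> 0" "u \<ge> s + \<gamma>" using 3 u by linarith+
    then have "\<gamma> - s \<le> 4 * (2 * u - s / 2)" by (simp add: field_simps)
    also have "\<dots> \<le> 4 * exp (2 * u - s / 2)"
      by (intro mult_left_mono order_trans[OF _ exp_ge_add_one_self]) auto
    finally have "4 * exp (2 * u - s / 2) \<ge> \<gamma> - s" .
    then show ?thesis unfolding potential_def using nn1 nn2 by linarith
  qed
qed

text \<open>The useful part is \<open>K * exp (- z)\<close>, whose expectation grows in every step.
  Completing it to a square gives the whole term a fixed sign, as the exit estimate
  requires.\<close>

lemma potential_square_expand:
  fixes K \<delta> z :: real
  assumes "\<delta> > 0"
  shows "K * \<delta> * (exp (- z) - 1 / (2 * \<delta>))\<^sup>2 = K * \<delta> * exp (- 2 * z) - K * exp (- z) + K / (4 * \<delta>)"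
proof -
  have "exp (- 2 * z) = (exp (- z))\<^sup>2" by (simp add: power2_eq_square flip: exp_add)
  then show ?thesis using assms by (simp add: power2_eq_square field_simps)
qed

text \<open>The bound consists of products of a function of \<open>s\<close> and \<open>u\<close>
  with a function of the new increment, so that independence applies term by term. The rate 3 comes
  from \<open>2 * u' + X \<le> 2 * r * u + 2 * y + y\<close>.\<close>

lemma potential_step:
  assumes nn: "K \<ge> 0" "\<delta> > 0" "L \<ge> 0" and r: "0 \<le> r" "r < 1"
    and u: "u \<ge> 0" "u' \<le> r * (u + y)" and X: "\<bar>X\<bar> \<le> y"
  shows "potential K \<delta> L \<gamma> (s + X) u' \<ge>
    (\<gamma> - s) - X - (exp (- (\<gamma> - s) + 2 * r * u) + 4 * exp (- (s / 2) + 2 * r * u)) * exp (3 * y)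
    - K * \<delta> * exp (- 2 * (\<gamma> - s)) * exp (2 * X) + K * exp (- (\<gamma> - s)) * exp X - K / (4 * \<delta>)
    - 4 * L * exp (- (s / 2)) * exp (- (X / 2))"
proof -
  have "r * y \<le> y" using r X by (intro mult_left_le_one_le) auto
  then have u': "2 * u' \<le> 2 * r * u + 2 * y" using u by (simp add: algebra_simps)
  have 1: "exp (2 * u' - (\<gamma> - (s + X))) \<le> exp (- (\<gamma> - s) + 2 * r * u) * exp (3 * y)"
    unfolding exp_add[symmetric] exp_le_cancel_iff using u' X by linarith
  have 2: "exp (- ((s + X) / 2)) * exp (2 * u') \<le> exp (- (s / 2) + 2 * r * u) * exp (3 * y)"
    unfolding exp_add[symmetric] exp_le_cancel_iff using u' X by (simp add: add_divide_distrib)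
  have 3: "exp (- ((s + X) / 2)) = exp (- (s / 2)) * exp (- (X / 2))"
    "exp (- 2 * (\<gamma> - (s + X))) = exp (- 2 * (\<gamma> - s)) * exp (2 * X)"
    "exp (- (\<gamma> - (s + X))) = exp (- (\<gamma> - s)) * exp X"
    by (simp_all add: algebra_simps add_divide_distrib flip: exp_add)
  have 4: "4 * exp (- ((s + X) / 2)) * (exp (2 * u') + L)
      \<le> 4 * (exp (- (s / 2) + 2 * r * u) * exp (3 * y)) + 4 * L * exp (- (s / 2)) * exp (- (X / 2))"
    using 2 unfolding distrib_left 3(1) by (simp add: mult_ac)
  have 5: "(a + 4 * b) * c = a * c + 4 * (b * c)" for a b c :: real by (simp add: algebra_simps)
  show ?thesis
    unfolding potential_def potential_square_expand[OF nn(2)] unfolding 3(2,3) 5 using 1 4 by (simp add: mult.assoc)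
qed

text \<open>The right side is the one-step bound with functions of the new increment replaced by
  moment bounds. By \<open>contr\<close>, each exponential in \<open>u\<close> costs an extra
  \<open>C\<close>. The gain \<open>K * m = 2 * C\<close> pays for the first one and for the
  quadratic term, where \<open>K * \<delta> * B = C\<close>; the last one is paid for by
  \<open>L - L * \<rho> = C\<close>.\<close>

lemma potential_drift:
  assumes m: "m > 0" and B: "B > 0" and C: "C \<ge> 0" and \<rho>: "\<rho> < 1"
    and contr: "B * exp (2 * r * u) \<le> exp (2 * u) + C"
    and K: "K = 2 * C / m" and \<delta>: "\<delta> = m / (2 * B)" and L: "L = C / (1 - \<rho>)" and s: "s \<le> \<gamma>"
  shows "potential K \<delta> L \<gamma> s u - m \<le>
    (\<gamma> - s) - m - B * (exp (- (\<gamma> - s) + 2 * r * u) + 4 * exp (- (s / 2) + 2 * r * u))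
    - K * \<delta> * B * exp (- 2 * (\<gamma> - s)) + K * (1 + m) * exp (- (\<gamma> - s)) - K / (4 * \<delta>)
    - 4 * L * \<rho> * exp (- (s / 2))"
proof -
  define a where "a = exp (- (\<gamma> - s))"
  define b where "b = exp (- (s / 2))"
  define d where "d = exp (- 2 * (\<gamma> - s))"
  have pos: "a > 0" "b > 0" "d > 0" by (auto simp: a_def b_def d_def)
  \<comment> \<open>This is where \<open>s \<le> \<gamma>\<close> enters: \<open>d\<close> is the
    square of \<open>a\<close>, and \<open>a\<close> is at most 1.\<close>
  have da: "d \<le> a" using s by (simp add: a_def d_def)
  have \<delta>0: "\<delta> > 0" using m B by (simp add: \<delta>)
  have K\<delta>: "K * \<delta> * B = C" "K * \<delta> \<ge> 0" "K * m = 2 * C" using m B C by (auto simp: K \<delta>)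
  have "L * (1 - \<rho>) = C" using \<rho> by (simp add: L)
  then have Lr: "L - L * \<rho> = C" by (simp add: algebra_simps)
  have e1: "B * (exp (- (\<gamma> - s) + 2 * r * u) + 4 * exp (- (s / 2) + 2 * r * u)) = (a + 4 * b) * (B * exp (2 * r * u))"
    unfolding exp_add a_def b_def by (simp add: algebra_simps)
  have e2: "(a + 4 * b) * (B * exp (2 * r * u)) \<le> (a + 4 * b) * (exp (2 * u) + C)"
    using contr pos by (intro mult_left_mono) auto
  have e3: "exp (2 * u - (\<gamma> - s)) = a * exp (2 * u)" unfolding a_def by (simp flip: exp_add)
  have e4: "C * d \<le> C * a" using da C by (rule mult_left_mono)
  have e5: "0 \<le> K * \<delta> * d" using K\<delta> pos by simp
  have e6: "4 * L * \<rho> * b = 4 * (L * b) - 4 * (C * b)" unfolding Lr[symmetric] by (simp add: algebra_simps)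
  have e7: "K * (1 + m) * a = K * a + 2 * (C * a)" using K\<delta>(3) by (simp add: algebra_simps)
  have e8: "(a + 4 * b) * (exp (2 * u) + C) = a * exp (2 * u) + 4 * (b * exp (2 * u)) + C * a + 4 * (C * b)"
    "4 * b * (exp (2 * u) + L) = 4 * (b * exp (2 * u)) + 4 * (L * b)" by (simp_all add: algebra_simps)
  show ?thesis
    unfolding potential_def potential_square_expand[OF \<delta>0]
    unfolding e1 e3 a_def[symmetric] b_def[symmetric] d_def[symmetric] K\<delta>(1) e6 e7 e8(2)
    using e2 e4 e5 unfolding e8(1) by linarith
qed

section \<open>Drift of the expected potential and the lower bound\<close>

context gaussian_consensus
begin

text \<open>Beyond \<open>alive\<close>, the average has to stay in the region where
  \<open>potential_drift\<close> holds. A smaller event is harmless for bounding the expected time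
  from below.\<close>

definition corridor :: "'n \<Rightarrow> real \<Rightarrow> nat \<Rightarrow> 'a set" where
  "corridor i \<gamma> t = {\<omega> \<in> space M. \<forall>s\<in>{1..t}. S s \<omega> $ i \<in> {-\<gamma>..\<gamma>} \<and> vmean (S s \<omega>) \<le> \<gamma>}"

lemma corridor_hist: "corridor i \<gamma> t \<in> sets (hist {1..t})"
proof -
  have [measurable]: "(\<lambda>\<omega>. S s \<omega> $ i) \<in> borel_measurable (hist {1..t})" "S s \<in> borel_measurable (hist {1..t})"
    if "s \<in> {1..t}" for s
    using measurable_S_hist[of s t] measurable_compose[OF measurable_S_hist[of s t] borel_measurable_nth] that by auto
  have "{\<omega> \<in> space (hist {1..t}). \<forall>s\<in>{1..t}. S s \<omega> $ i \<in> {-\<gamma>..\<gamma>} \<and> vmean (S s \<omega>) \<le> \<gamma>} \<in> sets (hist {1..t})"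
    by measurable
  then show ?thesis by (simp add: corridor_def)
qed

lemma corridor_events [measurable]: "corridor i \<gamma> t \<in> events"
  using corridor_hist sets_hist_subset[of "{1..t}"] by auto

lemma corridor_vmean_le: "\<omega> \<in> corridor i \<gamma> t \<Longrightarrow> \<gamma> > 0 \<Longrightarrow> vmean (S t \<omega>) \<le> \<gamma>"
  \<comment> \<open>At \<open>t = 0\<close> the corridor imposes nothing, but the average starts at
    0.\<close>
  by (cases "t = 0") (auto simp: corridor_def vmean_def[of 0])

lemma integrable_potential:
  assumes \<delta>: "\<delta> > 0"
  shows "integrable M (\<lambda>\<omega>. potential K \<delta> L \<gamma> (vmean (S t \<omega>)) (norm (deviation (S t \<omega>))))"
proof -
  define e where "e a b \<omega> = exp (a * vmean (S t \<omega>) + b * norm (deviation (S t \<omega>)))" for a b \<omega>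
  have int: "integrable M (e a b)" for a b unfolding e_def by (rule integrable_exp_state)
  have "potential K \<delta> L \<gamma> (vmean (S t \<omega>)) (norm (deviation (S t \<omega>)))
    = (\<gamma> - vmean (S t \<omega>)) - exp (- \<gamma>) * e 1 2 \<omega>
      - (K * \<delta> * exp (- 2 * \<gamma>) * e 2 0 \<omega> - K * exp (- \<gamma>) * e 1 0 \<omega> + K / (4 * \<delta>))
      - (4 * e (-1/2) 2 \<omega> + 4 * L * e (-1/2) 0 \<omega>)" for \<omega>
    unfolding potential_def potential_square_expand[OF \<delta>] e_def by (simp add: algebra_simps flip: exp_add)
  then show ?thesis
    by (auto intro!: Bochner_Integration.integrable_add Bochner_Integration.integrable_diff
        integrable_mult_right int integrable_vmean_S)
qed

text \<open>On the corridor the old potential minus \<open>m\<close> is at most \<open>Z\<close>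
  pointwise, \<open>Z\<close> is at most \<open>V\<close> in expectation by independence, and
  \<open>V\<close> bounds the new potential from below pointwise. Restricting to the next corridor
  then only helps, since the potential is nonpositive on leaving it.\<close>

lemma expectation_potential_step:
  fixes i :: 'n and t :: nat and \<gamma> :: real
  defines "B \<equiv> exp_norm_bound (real CARD('n)) m 3"
  assumes \<gamma>: "\<gamma> > 0" and C: "C \<ge> 0"
    and contr: "\<And>u. u \<ge> 0 \<Longrightarrow> B * exp (2 * r * u) \<le> exp (2 * u) + C"
    and K: "K = 2 * C / m" and \<delta>: "\<delta> = m / (2 * B)" and L: "L = C / (1 - exp (- (m / 4)))"
  defines "F \<equiv> \<lambda>t \<omega>. potential K \<delta> L \<gamma> (vmean (S t \<omega>)) (norm (deviation (S t \<omega>)))"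
  shows "expectation (\<lambda>\<omega>. F t \<omega> * indicator (corridor i \<gamma> t) \<omega>) - m * prob (corridor i \<gamma> t)
    \<le> expectation (\<lambda>\<omega>. F (Suc t) \<omega> * indicator (corridor i \<gamma> (Suc t)) \<omega>)"
proof -
  define A where "A = corridor i \<gamma> t"
  define \<rho> where "\<rho> = exp (- (m / 4))"
  have B: "B > 0" unfolding B_def exp_norm_bound_def by (intro mult_pos_pos add_pos_pos) auto
  have \<delta>0: "\<delta> > 0" using m_pos B by (simp add: \<delta>)
  have \<rho>: "\<rho> < 1" using m_pos by (simp add: \<rho>_def)
  have K0: "K \<ge> 0" "L \<ge> 0" using m_pos C \<rho> by (auto simp: K L \<rho>_def)
  have A [measurable]: "A \<in> sets (hist {1..t})" "A \<in> events"
    using corridor_hist corridor_events by (auto simp: A_def)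
  define s where "s = (\<lambda>\<omega>. vmean (S t \<omega>))"
  define u where "u = (\<lambda>\<omega>. norm (deviation (S t \<omega>)))"
  define X where "X = (\<lambda>\<omega>. vmean (\<eta> (Suc t) \<omega>))"
  define y where "y = (\<lambda>\<omega>. norm (\<eta> (Suc t) \<omega>))"
  define I where "I = (indicator A :: 'a \<Rightarrow> real)"
  have [measurable]: "s \<in> borel_measurable (hist {1..t})" "u \<in> borel_measurable (hist {1..t})"
    "I \<in> borel_measurable (hist {1..t})"
    unfolding s_def u_def I_def using measurable_S_hist[of t t, measurable] by measurable
  have int_e: "integrable M (\<lambda>\<omega>. exp (a * s \<omega> + b * u \<omega>))" for a b
    unfolding s_def u_def by (rule integrable_exp_state)
  have int_I: "integrable M (\<lambda>\<omega>. f \<omega> * I \<omega>)" if "integrable M f" for f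
    unfolding I_def using that A(2) by (rule integrable_real_mult_indicator[rotated])
  \<comment> \<open>\<open>U1\<close> to \<open>U5\<close> are the factors known at time
    \<open>t\<close>; membership in the corridor is known then as well.\<close>
  define U1 where "U1 = (\<lambda>\<omega>. (\<gamma> - s \<omega>) * I \<omega>)"
  define U2 where "U2 = (\<lambda>\<omega>. (exp (- (\<gamma> - s \<omega>) + 2 * r * u \<omega>) + 4 * exp (- (s \<omega> / 2) + 2 * r * u \<omega>)) * I \<omega>)"
  define U3 where "U3 = (\<lambda>\<omega>. exp (- 2 * (\<gamma> - s \<omega>)) * I \<omega>)"
  define U4 where "U4 = (\<lambda>\<omega>. exp (- (\<gamma> - s \<omega>)) * I \<omega>)"
  define U5 where "U5 = (\<lambda>\<omega>. exp (- (s \<omega> / 2)) * I \<omega>)"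
  have meas: "I \<in> borel_measurable (hist {1..t})" "U2 \<in> borel_measurable (hist {1..t})"
    "U3 \<in> borel_measurable (hist {1..t})" "U4 \<in> borel_measurable (hist {1..t})" "U5 \<in> borel_measurable (hist {1..t})"
    unfolding U2_def U3_def U4_def U5_def by measurable
  have int0: "integrable M I" using int_I[of "\<lambda>_. 1"] by simp
  have int1: "integrable M U1"
    unfolding U1_def s_def by (intro int_I Bochner_Integration.integrable_diff integrable_vmean_S) auto
  have int2: "integrable M U2"
  proof -
    have "(\<lambda>\<omega>. exp (- (\<gamma> - s \<omega>) + 2 * r * u \<omega>) + 4 * exp (- (s \<omega> / 2) + 2 * r * u \<omega>))
      = (\<lambda>\<omega>. exp (- \<gamma>) * exp (1 * s \<omega> + 2 * r * u \<omega>) + 4 * exp ((-1/2) * s \<omega> + 2 * r * u \<omega>))"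
      by (simp add: algebra_simps flip: exp_add)
    moreover have "integrable M \<dots>"
      by (intro Bochner_Integration.integrable_add integrable_mult_right int_e)
    ultimately show ?thesis unfolding U2_def by (intro int_I) simp
  qed
  have int3: "integrable M U3"
  proof -
    have "(\<lambda>\<omega>. exp (- 2 * (\<gamma> - s \<omega>))) = (\<lambda>\<omega>. exp (- 2 * \<gamma>) * exp (2 * s \<omega> + 0 * u \<omega>))"
      by (simp add: algebra_simps flip: exp_add)
    moreover have "integrable M \<dots>" by (intro integrable_mult_right int_e)
    ultimately show ?thesis unfolding U3_def by (intro int_I) simp
  qed
  have int4: "integrable M U4"
  proof -
    have "(\<lambda>\<omega>. exp (- (\<gamma> - s \<omega>))) = (\<lambda>\<omega>. exp (- \<gamma>) * exp (1 * s \<omega> + 0 * u \<omega>))"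
      by (simp add: algebra_simps flip: exp_add)
    moreover have "integrable M \<dots>" by (intro integrable_mult_right int_e)
    ultimately show ?thesis unfolding U4_def by (intro int_I) simp
  qed
  have int5: "integrable M U5"
    using int_I[OF int_e[of "-1/2" 0]] by (simp add: U5_def)
  have nn: "U2 \<omega> \<ge> 0" "U3 \<omega> \<ge> 0" "U4 \<omega> \<ge> 0" "U5 \<omega> \<ge> 0" for \<omega>
    unfolding U2_def U3_def U4_def U5_def I_def by auto
  have t1: "Suc t \<ge> 1" by simp
  note mom = vmean_eta_moments[OF t1]
  have int_exp: "integrable M (\<lambda>\<omega>. exp (3 * norm (\<eta> (Suc t) \<omega>)))"
    "expectation (\<lambda>\<omega>. exp (3 * norm (\<eta> (Suc t) \<omega>))) \<le> B"
    unfolding B_def by (rule integrable_exp_norm_eta; simp)+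
  have int_exp1: "integrable M (\<lambda>\<omega>. exp (vmean (\<eta> (Suc t) \<omega>)))" using mom(3)[of 1] by simp
  have int_exp5: "integrable M (\<lambda>\<omega>. exp (- (vmean (\<eta> (Suc t) \<omega>) / 2)))" using mom(3)[of "-1/2"] by simp
  have EX2: "expectation (\<lambda>\<omega>. exp (2 * vmean (\<eta> (Suc t) \<omega>))) \<le> B"
  proof -
    have "expectation (\<lambda>\<omega>. exp (2 * vmean (\<eta> (Suc t) \<omega>))) \<le> expectation (\<lambda>\<omega>. exp (3 * norm (\<eta> (Suc t) \<omega>)))"
    proof (intro integral_mono mom(3) int_exp)
      fix \<omega> show "exp (2 * vmean (\<eta> (Suc t) \<omega>)) \<le> exp (3 * norm (\<eta> (Suc t) \<omega>))"
        using abs_vmean_le[of "\<eta> (Suc t) \<omega>"] norm_ge_zero[of "\<eta> (Suc t) \<omega>"] by simp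
    qed
    then show ?thesis using int_exp(2) by simp
  qed
  note P0 = indep_past_next[OF meas(1) int0 borel_measurable_vmean mom(1)]
  have bm: "(\<lambda>x :: real^'n. exp (3 * norm x)) \<in> borel_measurable borel"
    "(\<lambda>x :: real^'n. exp (2 * vmean x)) \<in> borel_measurable borel"
    "(\<lambda>x :: real^'n. exp (vmean x)) \<in> borel_measurable borel"
    "(\<lambda>x :: real^'n. exp (- (vmean x / 2))) \<in> borel_measurable borel"
    by measurable
  note P2 = indep_past_next[OF meas(2) int2 bm(1) int_exp(1)]
  note P3 = indep_past_next[OF meas(3) int3 bm(2) mom(3)]
  note P4 = indep_past_next[OF meas(4) int4 bm(3) int_exp1]
  note P5 = indep_past_next[OF meas(5) int5 bm(4) int_exp5]
  define V where "V = (\<lambda>\<omega>. U1 \<omega> - I \<omega> * X \<omega> - U2 \<omega> * exp (3 * y \<omega>) - K * \<delta> * (U3 \<omega> * exp (2 * X \<omega>))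
     + K * (U4 \<omega> * exp (X \<omega>)) - K / (4 * \<delta>) * I \<omega> - 4 * L * (U5 \<omega> * exp (- (X \<omega> / 2))))"
  have ints: "integrable M (\<lambda>\<omega>. I \<omega> * X \<omega>)" "integrable M (\<lambda>\<omega>. U2 \<omega> * exp (3 * y \<omega>))"
    "integrable M (\<lambda>\<omega>. U3 \<omega> * exp (2 * X \<omega>))" "integrable M (\<lambda>\<omega>. U4 \<omega> * exp (X \<omega>))"
    "integrable M (\<lambda>\<omega>. U5 \<omega> * exp (- (X \<omega> / 2)))"
    unfolding X_def y_def using P0(1) P2(1) P3(1) P4(1) P5(1) .
  have int_V: "integrable M V"
    unfolding V_def by (intro Bochner_Integration.integrable_add Bochner_Integration.integrable_diff
        integrable_mult_right ints int1 int0)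
  have EV: "expectation V = expectation U1 - m * expectation I
     - expectation U2 * expectation (\<lambda>\<omega>. exp (3 * norm (\<eta> (Suc t) \<omega>)))
     - K * \<delta> * (expectation U3 * expectation (\<lambda>\<omega>. exp (2 * vmean (\<eta> (Suc t) \<omega>))))
     + K * (expectation U4 * expectation (\<lambda>\<omega>. exp (vmean (\<eta> (Suc t) \<omega>)))) - K / (4 * \<delta>) * expectation I
     - 4 * L * (expectation U5 * expectation (\<lambda>\<omega>. exp (- (vmean (\<eta> (Suc t) \<omega>) / 2))))"
    unfolding V_def using ints int0 int1 P0(2) P2(2) P3(2) P4(2) P5(2) mom(2)
    by (simp add: X_def y_def mult.commute[of m])
  define Z where "Z = (\<lambda>\<omega>. U1 \<omega> - m * I \<omega> - B * U2 \<omega> - K * \<delta> * B * U3 \<omega> + K * (1 + m) * U4 \<omega>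
     - K / (4 * \<delta>) * I \<omega> - 4 * L * \<rho> * U5 \<omega>)"
  have int_Z: "integrable M Z"
    unfolding Z_def by (intro Bochner_Integration.integrable_add Bochner_Integration.integrable_diff
        integrable_mult_right int0 int1 int2 int3 int4 int5)
  have EZ: "expectation Z = expectation U1 - m * expectation I - B * expectation U2 - K * \<delta> * B * expectation U3
     + K * (1 + m) * expectation U4 - K / (4 * \<delta>) * expectation I - 4 * L * \<rho> * expectation U5"
    unfolding Z_def using int0 int1 int2 int3 int4 int5 by simp
  have "expectation Z \<le> expectation V"
  proof -
    have E: "expectation U2 \<ge> 0" "expectation U3 \<ge> 0" "expectation U4 \<ge> 0" "expectation U5 \<ge> 0"
      using nn by (auto intro!: integral_nonneg_AE AE_I2)
    have "expectation U2 * expectation (\<lambda>\<omega>. exp (3 * norm (\<eta> (Suc t) \<omega>))) \<le> B * expectation U2"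
      using mult_left_mono[OF int_exp(2) E(1)] by (simp add: mult.commute)
    moreover have "K * \<delta> * (expectation U3 * expectation (\<lambda>\<omega>. exp (2 * vmean (\<eta> (Suc t) \<omega>)))) \<le> K * \<delta> * B * expectation U3"
      using mult_left_mono[OF mult_left_mono[OF EX2 E(2)], of "K * \<delta>"] K0 \<delta>0 by (simp add: mult_ac)
    moreover have "K * (1 + m) * expectation U4 \<le> K * (expectation U4 * expectation (\<lambda>\<omega>. exp (vmean (\<eta> (Suc t) \<omega>))))"
      using mult_left_mono[OF mult_left_mono[OF mom(4) E(3)] K0(1)] by (simp add: mult_ac)
    moreover have "4 * L * (expectation U5 * expectation (\<lambda>\<omega>. exp (- (vmean (\<eta> (Suc t) \<omega>) / 2)))) \<le> 4 * L * \<rho> * expectation U5"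
      using mult_left_mono[OF mult_left_mono[OF mom(5) E(4)], of "4 * L"] K0 by (simp add: mult_ac \<rho>_def)
    ultimately show ?thesis unfolding EV EZ by linarith
  qed
  have F: "integrable M (F t)" for t unfolding F_def by (rule integrable_potential[OF \<delta>0])
  have F_Z: "F t \<omega> * I \<omega> - m * I \<omega> \<le> Z \<omega>" for \<omega>
  proof (cases "\<omega> \<in> A")
    case True
    then have "s \<omega> \<le> \<gamma>" unfolding A_def s_def using \<gamma> by (rule corridor_vmean_le)
    then have "F t \<omega> - m \<le> Z \<omega>"
      unfolding F_def Z_def U1_def U2_def U3_def U4_def U5_def
      using potential_drift[OF m_pos B C \<rho> contr K \<delta> L[folded \<rho>_def], of "u \<omega>" "s \<omega>" \<gamma>] True
      by (simp add: I_def u_def s_def)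
    then show ?thesis using True by (simp add: I_def)
  qed (simp add: Z_def U1_def U2_def U3_def U4_def U5_def I_def)
  have V_F: "V \<omega> \<le> F (Suc t) \<omega> * indicator (corridor i \<gamma> (Suc t)) \<omega>" if \<omega>: "\<omega> \<in> space M" for \<omega>
  proof (cases "\<omega> \<in> A")
    case True
    have "V \<omega> \<le> F (Suc t) \<omega>"
      unfolding F_def vmean_S_Suc s_def[symmetric, THEN fun_cong] X_def[symmetric, THEN fun_cong]
        V_def U1_def U2_def U3_def U4_def U5_def
      using potential_step[OF K0(1) \<delta>0 K0(2) r_nonneg r_less_1 norm_ge_zero norm_deviation_S_Suc[of t \<omega>]
          abs_vmean_le[of "\<eta> (Suc t) \<omega>"], where \<gamma>=\<gamma> and s="s \<omega>"] True
      by (simp add: I_def u_def X_def y_def mult.assoc del: agent_stat.simps)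
    moreover have "F (Suc t) \<omega> \<le> 0" if "\<omega> \<notin> corridor i \<gamma> (Suc t)"
      unfolding F_def
    proof (rule potential_exit_nonpos)
      show "\<bar>S (Suc t) \<omega> $ i - vmean (S (Suc t) \<omega>)\<bar> \<le> norm (deviation (S (Suc t) \<omega>))"
        using component_le_norm_cart[of "deviation (S (Suc t) \<omega>)" i] unfolding deviation_def by simp
      show "\<not> (S (Suc t) \<omega> $ i \<in> {- \<gamma>..\<gamma>} \<and> vmean (S (Suc t) \<omega>) \<le> \<gamma>)"
        using that True \<omega> unfolding A_def corridor_def atLeastAtMostSuc_conv by (auto simp del: agent_stat.simps simp: le_Suc_eq)
    qed (use K0 \<delta>0 in auto)
    ultimately show ?thesis by (cases "\<omega> \<in> corridor i \<gamma> (Suc t)") auto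
  next
    case False
    \<comment> \<open>Corridors decrease with time, so both sides vanish.\<close>
    then have "\<omega> \<notin> corridor i \<gamma> (Suc t)" unfolding A_def corridor_def by auto
    then show ?thesis using False by (simp add: V_def U1_def U2_def U3_def U4_def U5_def I_def)
  qed
  have "expectation (\<lambda>\<omega>. F t \<omega> * indicator A \<omega>) - m * prob A = expectation (\<lambda>\<omega>. F t \<omega> * I \<omega> - m * I \<omega>)"
    using int_I[OF F[of t]] int0 A(2) by (simp add: I_def)
  also have "\<dots> \<le> expectation Z"
    using int_I[OF F[of t]] int0 int_Z F_Z by (intro integral_mono) auto
  also have "\<dots> \<le> expectation V" by fact
  also have "\<dots> \<le> expectation (\<lambda>\<omega>. F (Suc t) \<omega> * indicator (corridor i \<gamma> (Suc t)) \<omega>)"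
    using int_V integrable_real_mult_indicator[OF corridor_events F[of "Suc t"]] V_F
    by (intro integral_mono) auto
  finally show ?thesis unfolding A_def .
qed

text \<open>The one-step estimate is telescoped up to a time \<open>n\<close>. The potential starts
  at \<open>\<gamma>\<close> minus a constant, and \<open>n\<close> is so late that its remaining
  expectation is bounded by a constant. Neither constant depends on \<open>\<gamma>\<close>.\<close>

lemma sum_prob_alive_ge:
  fixes i :: 'n and \<gamma> :: real
  defines "B \<equiv> exp_norm_bound (real CARD('n)) m 3"
  assumes \<gamma>: "\<gamma> > 0" and C: "C \<ge> 0"
    and contr: "\<And>u. u \<ge> 0 \<Longrightarrow> B * exp (2 * r * u) \<le> exp (2 * u) + C"
    and K: "K = 2 * C / m" and \<delta>: "\<delta> = m / (2 * B)" and L: "L = C / (1 - exp (- (m / 4)))"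
    and sm: "summable (\<lambda>t. prob (alive i (- \<gamma>) \<gamma> t))"
  shows "\<gamma> - (1 + (K * \<delta> + K / (4 * \<delta>)) + 4 * (1 + L) + 1 + B / (1 - r))
    \<le> m * (\<Sum>t. prob (alive i (- \<gamma>) \<gamma> t))"
proof -
  have B: "B > 0" unfolding B_def exp_norm_bound_def by (intro mult_pos_pos add_pos_pos) auto
  have \<delta>0: "\<delta> > 0" using m_pos B by (simp add: \<delta>)
  have K0: "K \<ge> 0" "L \<ge> 0" using m_pos C by (auto simp: K L)
  define F where "F = (\<lambda>t \<omega>. potential K \<delta> L \<gamma> (vmean (S t \<omega>)) (norm (deviation (S t \<omega>))))"
  define a where "a t = expectation (\<lambda>\<omega>. F t \<omega> * indicator (corridor i \<gamma> t) \<omega>)" for t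
  have step: "a t - m * prob (corridor i \<gamma> t) \<le> a (Suc t)" for t
    using expectation_potential_step[OF \<gamma> C contr[unfolded B_def] K \<delta>[unfolded B_def] L]
    by (simp add: a_def F_def)
  have iter: "a 0 - m * (\<Sum>t<n. prob (corridor i \<gamma> t)) \<le> a n" for n
  proof (induction n)
    case (Suc n)
    then show ?case using step[of n] by (simp add: algebra_simps)
  qed simp
  have "a 0 = potential K \<delta> L \<gamma> 0 0"
    by (simp add: a_def F_def corridor_def vmean_def deviation_def norm_vec_def L2_set_def prob_space)
  also have "\<dots> \<ge> \<gamma> - 1 - (K * \<delta> + K / (4 * \<delta>)) - 4 * (1 + L)"
  proof -
    have "K * \<delta> * exp (- 2 * \<gamma>) \<le> K * \<delta> * 1" using K0 \<delta>0 \<gamma> by (intro mult_left_mono) auto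
    moreover have "0 \<le> K * exp (- \<gamma>)" using K0 by simp
    moreover have "exp (- \<gamma>) \<le> 1" using \<gamma> by simp
    moreover have "potential K \<delta> L \<gamma> 0 0
        = \<gamma> - exp (- \<gamma>) - (K * \<delta> * exp (- 2 * \<gamma>) - K * exp (- \<gamma>) + K / (4 * \<delta>)) - 4 * (1 + L)"
      unfolding potential_square_expand[OF \<delta>0, of K \<gamma>, symmetric] by (simp add: potential_def)
    ultimately show ?thesis by linarith
  qed
  finally have a0: "\<gamma> - 1 - (K * \<delta> + K / (4 * \<delta>)) - 4 * (1 + L) \<le> a 0" .
  have sub: "corridor i \<gamma> t \<subseteq> alive i (- \<gamma>) \<gamma> t" for t by (auto simp: corridor_def alive_def)
  have alive_ev: "alive i (- \<gamma>) \<gamma> t \<in> events" for t unfolding alive_def by measurable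
  have le: "prob (corridor i \<gamma> t) \<le> prob (alive i (- \<gamma>) \<gamma> t)" for t
    by (rule finite_measure_mono[OF sub alive_ev])
  have "(\<lambda>t. prob (alive i (- \<gamma>) \<gamma> t)) \<longlonglongrightarrow> 0" using sm by (rule summable_LIMSEQ_zero)
  then have "\<forall>\<^sub>F t in sequentially. prob (alive i (- \<gamma>) \<gamma> t) < 1 / (2 * \<gamma>)"
    by (rule order_tendstoD) (use \<gamma> in simp)
  \<comment> \<open>On the corridor the potential is at most \<open>2 * \<gamma>\<close> plus the
    deviation, so this probability contributes at most 1. Only for \<open>n \<ge> 1\<close> does the
    corridor constrain the statistic at time \<open>n\<close>.\<close>
  then obtain n where n: "n \<ge> 1" "prob (alive i (- \<gamma>) \<gamma> n) < 1 / (2 * \<gamma>)"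
    using eventually_sequentially[THEN iffD1] by (metis max.cobounded1 max.cobounded2)
  have F: "integrable M (F t)" for t unfolding F_def by (rule integrable_potential[OF \<delta>0])
  note dev = expectation_norm_deviation_S[of n, folded B_def]
  have int_cor: "integrable M (indicat_real (corridor i \<gamma> n))"
    using integrable_real_mult_indicator[OF corridor_events, of "\<lambda>_. 1"] by simp
  have "a n \<le> expectation (\<lambda>\<omega>. 2 * \<gamma> * indicator (corridor i \<gamma> n) \<omega> + norm (deviation (S n \<omega>)))"
    unfolding a_def
  proof (rule integral_mono)
    show "integrable M (\<lambda>\<omega>. F n \<omega> * indicator (corridor i \<gamma> n) \<omega>)"
      by (rule integrable_real_mult_indicator[OF corridor_events F])
    show "integrable M (\<lambda>\<omega>. 2 * \<gamma> * indicator (corridor i \<gamma> n) \<omega> + norm (deviation (S n \<omega>)))"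
      using dev(1) by (intro Bochner_Integration.integrable_add integrable_mult_right int_cor)
    fix \<omega> assume "\<omega> \<in> space M"
    show "F n \<omega> * indicator (corridor i \<gamma> n) \<omega> \<le> 2 * \<gamma> * indicator (corridor i \<gamma> n) \<omega> + norm (deviation (S n \<omega>))"
    proof (cases "\<omega> \<in> corridor i \<gamma> n")
      case True
      then have "- \<gamma> \<le> S n \<omega> $ i" using n(1) by (auto simp: corridor_def)
      moreover have "\<bar>S n \<omega> $ i - vmean (S n \<omega>)\<bar> \<le> norm (deviation (S n \<omega>))"
        using component_le_norm_cart[of "deviation (S n \<omega>)" i] unfolding deviation_def by simp
      moreover have "F n \<omega> \<le> \<gamma> - vmean (S n \<omega>)"
      proof -
        have "0 \<le> K * \<delta> * (exp (- (\<gamma> - vmean (S n \<omega>))) - 1 / (2 * \<delta>))\<^sup>2" using K0 \<delta>0 by simp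
        moreover have "0 \<le> 4 * exp (- (vmean (S n \<omega>) / 2)) * (exp (2 * norm (deviation (S n \<omega>))) + L)"
          using K0 by simp
        moreover have "0 \<le> exp (2 * norm (deviation (S n \<omega>)) - (\<gamma> - vmean (S n \<omega>)))" by simp
        ultimately show ?thesis unfolding F_def potential_def by linarith
      qed
      ultimately have "F n \<omega> \<le> 2 * \<gamma> + norm (deviation (S n \<omega>))" by linarith
      then show ?thesis using True by simp
    qed simp
  qed
  also have "\<dots> = 2 * \<gamma> * prob (corridor i \<gamma> n) + expectation (\<lambda>\<omega>. norm (deviation (S n \<omega>)))"
    using dev(1) int_cor by (subst Bochner_Integration.integral_add) auto
  also have "\<dots> \<le> 2 * \<gamma> * (1 / (2 * \<gamma>)) + B / (1 - r)"
    using n(2) le[of n] dev(2) \<gamma> by (intro add_mono mult_left_mono) auto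
  finally have an: "a n \<le> 1 + B / (1 - r)" using \<gamma> by simp
  have "(\<Sum>t<n. prob (corridor i \<gamma> t)) \<le> (\<Sum>t<n. prob (alive i (- \<gamma>) \<gamma> t))"
    using le by (rule sum_mono)
  also have "\<dots> \<le> (\<Sum>t. prob (alive i (- \<gamma>) \<gamma> t))"
    by (rule sum_le_suminf[OF sm]) auto
  finally have "m * (\<Sum>t<n. prob (corridor i \<gamma> t)) \<le> m * (\<Sum>t. prob (alive i (- \<gamma>) \<gamma> t))"
    using m_pos by (intro mult_left_mono) auto
  then show ?thesis using iter[of n] a0 an by linarith
qed

end

section \<open>The expected exit time\<close>

lemma gaussian_consensus_of_model:
  fixes W :: "real^'n::finite^'n"
  assumes "\<mu> \<noteq> 0" "\<sigma> > 0" "weight_matrix E W" and m: "m = 2 * \<mu>\<^sup>2 / \<sigma>\<^sup>2"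
    and r: "r = onorm (\<lambda>x. (W - averaging_matrix) *v x)" "r < 1"
    and model: "gaussian_shift_model \<mu> \<sigma> P (y :: 'n \<Rightarrow> nat \<Rightarrow> 'a \<Rightarrow> real)"
  shows "gaussian_consensus (P H1) (llr \<mu> \<sigma> y) m r E W"
proof -
  interpret prob_space "P H1" using model by (simp add: gaussian_shift_model_def)
  have ind: "indep_vars (\<lambda>_. borel) (\<lambda>(i, t) \<omega>. y i t \<omega> - \<mu>) (UNIV \<times> {1..})"
    and dist: "\<And>i t. t \<ge> 1 \<Longrightarrow> distributed (P H1) lborel (\<lambda>\<omega>. y i t \<omega> - \<mu>) (normal_density 0 \<sigma>)"
    using model unfolding gaussian_shift_model_def by (metis signal_mean.simps(2))+
  define c where "c = 2 * \<mu> / \<sigma>\<^sup>2"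
  have c: "c \<noteq> 0" using assms by (simp add: c_def)
  have llr: "llr \<mu> \<sigma> y t \<omega> $ i = m + c * (y i t \<omega> - \<mu>)" for t \<omega> i
    using assms(2) by (simp add: llr_def m c_def field_simps power2_eq_square)
  \<comment> \<open>The ratio is affine in the noise with slope \<open>c\<close>, so this is its
    standard deviation.\<close>
  have "\<bar>c\<bar> * \<sigma> = sqrt ((\<bar>c\<bar> * \<sigma>)\<^sup>2)" using assms(2) by simp
  also have "(\<bar>c\<bar> * \<sigma>)\<^sup>2 = 2 * m" using assms(2) by (simp add: c_def m power2_eq_square)
  finally have sd: "\<bar>c\<bar> * \<sigma> = sqrt (2 * m)" .
  show ?thesis
  proof
    show "m > 0" using assms by simp
    have "indep_vars (\<lambda>_. borel) (\<lambda>p \<omega>. m + c * (case p of (i, t) \<Rightarrow> (\<lambda>\<omega>. y i t \<omega> - \<mu>)) \<omega>) (UNIV \<times> {1..})"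
      by (rule indep_vars_compose2[OF ind]) auto
    then show "indep_vars (\<lambda>_. borel) (\<lambda>(i, t) \<omega>. llr \<mu> \<sigma> y t \<omega> $ i) (UNIV \<times> {1..})"
      unfolding llr by (simp add: case_prod_unfold)
    show "distributed (P H1) lborel (\<lambda>\<omega>. llr \<mu> \<sigma> y t \<omega> $ i) (normal_density m (sqrt (2 * m)))" if "t \<ge> 1" for t i
      using normal_density_affine[OF dist[OF that] assms(2) c, of m] unfolding llr sd by simp
  qed (use assms in auto)
qed

theorem theorem4p7:
  fixes \<mu> \<sigma> m r k N :: real
    and E :: "('n::finite \<times> 'n) set"
    and W :: "real^'n^'n"
  assumes "\<mu> \<noteq> 0" and "\<sigma> > 0"
    and "connected_simple_graph E"
    and "weight_matrix E W"
    and "N = real CARD('n)"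
    and "m = 2 * \<mu>\<^sup>2 / \<sigma>\<^sup>2"
    and "r = onorm (\<lambda>x. (W - averaging_matrix) *v x)"
    and "r < 1"
    and "k = N * r\<^sup>2"
  shows "\<exists>c>0. \<forall>(P :: hyp \<Rightarrow> 'a measure) (y :: 'n \<Rightarrow> nat \<Rightarrow> 'a \<Rightarrow> real).
    gaussian_shift_model \<mu> \<sigma> P y \<longrightarrow>
    (\<forall>\<epsilon> (\<gamma>h :: 'n \<Rightarrow> real) (\<gamma>l :: 'n \<Rightarrow> real).
       0 < \<epsilon> \<and> \<epsilon> < 1/2 \<and>
       (\<forall>i. \<gamma>h i = 8 * (k + 1) / (7 * N) *
                (ln (2 / \<epsilon>) - ln (1 - exp (- (N * m / (4 * (k + 1))))))) \<and>
       (\<forall>i. \<gamma>l i = 8 * (k + 1) / (7 * N) *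
                (ln (\<epsilon> / 2) + ln (1 - exp (- (N * m / (4 * (k + 1))))))) \<longrightarrow>
       (\<forall>i. let ET = expected_time (P H1)
                       (exit_time (agent_stat W (llr \<mu> \<sigma> y)) i (\<gamma>l i) (\<gamma>h i))
            in ereal ((1 - 2 * \<epsilon>) * \<gamma>h i / m - c / m) \<le> ET \<and>
               ET \<le> ereal (5 * \<gamma>h i / (4 * m) + 1 / (1 - exp (- (N * m / (4 * (k + 1))))))))"
proof -
  define q where "q = N * m / (4 * (k + 1))"
  define B where "B = exp_norm_bound N m 3"
  have N: "N > 0" using assms(5) by simp
  have m: "m > 0" using assms(1,2,6) by simp
  have k: "k \<ge> 0" using assms(9) N by simp
  have q: "q > 0" using N m k by (simp add: q_def)
  have B: "B > 0" unfolding B_def exp_norm_bound_def using N by (intro mult_pos_pos add_pos_pos) auto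
  have r0: "r \<ge> 0" unfolding assms(7) by (rule onorm_pos_le) simp
  obtain C where C: "C \<ge> 0" "\<And>u. u \<ge> 0 \<Longrightarrow> B * exp (2 * r * u) \<le> exp (2 * u) + C"
    using exp_contraction_bound[OF r0 assms(8) B] by blast
  define K where "K = 2 * C / m"
  define \<delta> where "\<delta> = m / (2 * B)"
  define L where "L = C / (1 - exp (- (m / 4)))"
  \<comment> \<open>The loss in \<open>sum_prob_alive_ge\<close>; it is built from \<open>N\<close>,
    \<open>m\<close> and \<open>r\<close> alone, before \<open>\<epsilon>\<close> and the laws are
    given.\<close>
  define c where "c = 1 + (K * \<delta> + K / (4 * \<delta>)) + 4 * (1 + L) + 1 + B / (1 - r)"
  have "K \<ge> 0" "\<delta> \<ge> 0" "L \<ge> 0" using C(1) m B by (auto simp: K_def \<delta>_def L_def)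
  then have c: "c > 0" unfolding c_def using B assms(8) by (simp add: add_nonneg_pos add_pos_nonneg add_nonneg_nonneg)
  show ?thesis
  proof (intro exI[of _ c] conjI c allI impI)
    fix P :: "hyp \<Rightarrow> 'a measure" and y :: "'n \<Rightarrow> nat \<Rightarrow> 'a \<Rightarrow> real"
      and \<epsilon> :: real and \<gamma>h \<gamma>l :: "'n \<Rightarrow> real" and i :: 'n
    assume model: "gaussian_shift_model \<mu> \<sigma> P y"
    assume "0 < \<epsilon> \<and> \<epsilon> < 1/2 \<and>
       (\<forall>i. \<gamma>h i = 8 * (k + 1) / (7 * N) *
                (ln (2 / \<epsilon>) - ln (1 - exp (- (N * m / (4 * (k + 1))))))) \<and>
       (\<forall>i. \<gamma>l i = 8 * (k + 1) / (7 * N) *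
                (ln (\<epsilon> / 2) + ln (1 - exp (- (N * m / (4 * (k + 1)))))))"
    then have \<epsilon>: "0 < \<epsilon>" "\<epsilon> < 1/2"
      and h: "\<gamma>h i = 8 * (k + 1) / (7 * N) * (ln (2 / \<epsilon>) - ln (1 - exp (- q)))"
      and l: "\<gamma>l i = 8 * (k + 1) / (7 * N) * (ln (\<epsilon> / 2) + ln (1 - exp (- q)))"
      by (auto simp: q_def)
    interpret gaussian_consensus "P H1" "llr \<mu> \<sigma> y" m r E W
      by (rule gaussian_consensus_of_model[OF assms(1,2,4,6,7,8) model])
    have "ln (\<epsilon> / 2) = - ln (2 / \<epsilon>)" using \<epsilon> by (simp add: ln_div)
    then have neg: "ln (\<epsilon> / 2) + ln (1 - exp (- q)) = - (ln (2 / \<epsilon>) - ln (1 - exp (- q)))" by simp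
    \<comment> \<open>The interval is symmetric, as the lower bound requires.\<close>
    have lh: "\<gamma>l i = - \<gamma>h i" unfolding l h neg by (rule mult_minus_right)
    have "ln (1 - exp (- q)) \<le> 0" using q by simp
    moreover have "ln 4 \<le> ln (2 / \<epsilon>)" using \<epsilon> by (subst ln_le_cancel_iff) (auto simp: field_simps)
    ultimately have ln4: "ln 4 \<le> ln (2 / \<epsilon>) - ln (1 - exp (- q))" by simp
    \<comment> \<open>The prefactor of the threshold cancels \<open>q / m\<close> up to
      \<open>2/7\<close>; together with \<open>2 / \<epsilon> > 4\<close> this gives the hypothesis
      of the series bound.\<close>
    have "q * (\<gamma>h i / m) = 2/7 * (ln (2 / \<epsilon>) - ln (1 - exp (- q)))"
    proof -
      have "q * (8 * (k + 1) / (7 * N) * a / m) = 2/7 * a" for a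
        using N m k by (simp add: q_def divide_simps)
      then show ?thesis unfolding h .
    qed
    then have qx: "2/7 * ln 4 \<le> q * (\<gamma>h i / m)" using ln4 by simp
    have "0 < 2/7 * ln (4::real)" by simp
    then have "0 < q * (\<gamma>h i / m)" using qx by linarith
    then have h0: "\<gamma>h i > 0" using q m by (simp add: zero_less_mult_iff zero_less_divide_iff)
    note q_eq = q_def[unfolded assms(9), unfolded assms(5)]
    note up = expected_exit_time_upper[OF qx[unfolded q_eq], where i=i and l="- \<gamma>h i", folded q_eq]
    have "\<gamma>h i - c \<le> m * (\<Sum>t. prob (alive i (- \<gamma>h i) (\<gamma>h i) t))"
      using sum_prob_alive_ge[OF h0 C(1) C(2)[unfolded B_def assms(5)] K_def \<delta>_def[unfolded B_def assms(5)] L_def up(1)]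
      by (simp add: c_def B_def assms(5))
    \<comment> \<open>The estimate holds with \<open>\<gamma>h i\<close> itself, and the factor only
      lowers the left side.\<close>
    moreover have "(1 - 2 * \<epsilon>) * \<gamma>h i \<le> \<gamma>h i" using \<epsilon> h0 by simp
    ultimately have "(1 - 2 * \<epsilon>) * \<gamma>h i - c \<le> m * (\<Sum>t. prob (alive i (- \<gamma>h i) (\<gamma>h i) t))" by linarith
    then have "((1 - 2 * \<epsilon>) * \<gamma>h i - c) / m \<le> (\<Sum>t. prob (alive i (- \<gamma>h i) (\<gamma>h i) t))"
      using m by (simp add: pos_divide_le_eq mult.commute)
    then have "ereal ((1 - 2 * \<epsilon>) * \<gamma>h i / m - c / m) \<le> expected_time (P H1) (exit_time S i (\<gamma>l i) (\<gamma>h i))"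
      unfolding lh up(2) by (simp add: diff_divide_distrib)
    moreover have "expected_time (P H1) (exit_time S i (\<gamma>l i) (\<gamma>h i)) \<le> ereal (5 * \<gamma>h i / (4 * m) + 1 / (1 - exp (- q)))"
      unfolding lh using up(3) by simp
    ultimately show "let ET = expected_time (P H1) (exit_time S i (\<gamma>l i) (\<gamma>h i))
            in ereal ((1 - 2 * \<epsilon>) * \<gamma>h i / m - c / m) \<le> ET \<and>
               ET \<le> ereal (5 * \<gamma>h i / (4 * m) + 1 / (1 - exp (- (N * m / (4 * (k + 1))))))"
      by (simp add: q_def)
  qed
qed

end
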